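(* Let $p$ be a prime, let $F=\{0,1,\ldots,p-1\}$ be the finite field with $p$ elements, let $A=\operatorname{Aff}(F)$ be the affine group of $F$, and let $C=\langle c\rangle$ be a cyclic group of order $p$ with generator $c$ and identity $e$. Let $K=C^F=\{f:F\to C\}$, a group under pointwise multiplication, on which $A$ acts via its action on $F$, and let $G=K\rtimes A$ be the wreath product of $C$ and $A$ relative to $F$. Set $a=(c,e,e,\ldots,e)\in K$. Then $a\in G$, the conjugacy class $\operatorname{Cl}(a)$ of $G$ has size $p$, and $$\operatorname{Cl}(a)\operatorname{Cl}(a^{-1})=\operatorname{Cl}((e,e,\ldots,e))\cup\operatorname{Cl}((c,c^{-1},e,\ldots,e)).$$ Thus $\eta(\operatorname{Cl}(a)\operatorname{Cl}(a^{-1}))=2$. Therefore, given any prime $p$, there exist a finite supersolvable group $G$ and a conjugacy class $\operatorname{Cl}(a)$ of $G$ with $|\operatorname{Cl}(a)|=p$ and $\eta(\operatorname{Cl}(a)\operatorname{Cl}(a^{-1}))=2$.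
   Context: For a finite group $G$ and $a\in G$, $\operatorname{Cl}(a)=\{gag^{-1}\mid g\in G\}$ is the conjugacy class of $a$ in $G$. For subsets $X,Y$ of $G$, $XY=\{xy\mid x\in X, y\in Y\}$. If a subset $X$ of $G$ is $G$-invariant (stable under conjugation by all elements of $G$), then $X$ is a union of $m$ distinct conjugacy classes of $G$ for some integer $m$, and $\eta(X)=m$ denotes this number. A product of two conjugacy classes is $G$-invariant. The affine group $\operatorname{Aff}(F)$ is the group of maps $x\mapsto ux+v$ with $u\in F\setminus\{0\}$, $v\in F$ (with $F$ regarded as a one-dimensional vector space over itself). Elements of $K$ are written as tuples $(f(0),f(1),\ldots,f(p-1))$. *)

theory Defs
  imports "HOL-Algebra.Product_Groups" "HOL-Algebra.Bij" "HOL-Algebra.Solvable_Groups" "HOL-Number_Theory.Residues"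
begin

section \<open>Conjugacy classes\<close>

definition conj_class :: "('a, 'b) monoid_scheme \<Rightarrow> 'a \<Rightarrow> 'a set" where
  "conj_class G a = {g \<otimes>\<^bsub>G\<^esub> a \<otimes>\<^bsub>G\<^esub> inv\<^bsub>G\<^esub> g | g. g \<in> carrier G}"

definition conj_classes :: "('a, 'b) monoid_scheme \<Rightarrow> 'a set set" where
  "conj_classes G = conj_class G ` carrier G"

text \<open>Only meaningful for finite, conjugation-invariant \<open>Y\<close>; see \<open>eta_eqI\<close> below.\<close>

definition eta :: "('a, 'b) monoid_scheme \<Rightarrow> 'a set \<Rightarrow> nat" where
  "eta G Y = card {D \<in> conj_classes G. D \<subseteq> Y}"

lemma (in group) conj_class_self: "a \<in> carrier G \<Longrightarrow> a \<in> conj_class G a"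
  unfolding conj_class_def by (force intro: exI[of _ \<one>])

lemma (in group) conj_class_eqI:
  assumes a: "a \<in> carrier G" and b: "b \<in> conj_class G a"
  shows "conj_class G b = conj_class G a"
proof -
  from b obtain g where g: "g \<in> carrier G" and bg: "b = g \<otimes> a \<otimes> inv g"
    by (auto simp: conj_class_def)
  have 1: "h \<otimes> b \<otimes> inv h = (h \<otimes> g) \<otimes> a \<otimes> inv (h \<otimes> g)" if "h \<in> carrier G" for h
    using that a g by (simp add: bg m_assoc inv_mult_group)
  have 2: "h \<otimes> a \<otimes> inv h = (h \<otimes> inv g) \<otimes> b \<otimes> inv (h \<otimes> inv g)" if "h \<in> carrier G" for h
  proof -
    have "(h \<otimes> inv g) \<otimes> b \<otimes> inv (h \<otimes> inv g)
        = (h \<otimes> inv g \<otimes> g) \<otimes> a \<otimes> inv (h \<otimes> inv g \<otimes> g)"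
      using 1[of "h \<otimes> inv g"] that g by simp
    also have "h \<otimes> inv g \<otimes> g = h" using that g by (simp add: m_assoc)
    finally show ?thesis by simp
  qed
  show ?thesis
  proof
    show "conj_class G b \<subseteq> conj_class G a"
      using 1 g by (fastforce simp: conj_class_def)
    show "conj_class G a \<subseteq> conj_class G b"
    proof
      fix x assume "x \<in> conj_class G a"
      then obtain h where h: "h \<in> carrier G" "x = h \<otimes> a \<otimes> inv h"
        by (auto simp: conj_class_def)
      have "h \<otimes> inv g \<in> carrier G" using h g by simp
      then show "x \<in> conj_class G b"
        using 2[OF h(1)] h(2) unfolding conj_class_def by blast
    qed
  qed
qed

lemma (in group) eta_eqI:
  assumes S: "S \<subseteq> conj_classes G" and Y: "Y = \<Union>S"
  shows "eta G Y = card S"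
proof -
  have "{D \<in> conj_classes G. D \<subseteq> Y} = S"
  proof
    show "S \<subseteq> {D \<in> conj_classes G. D \<subseteq> Y}" using S Y by auto
    show "{D \<in> conj_classes G. D \<subseteq> Y} \<subseteq> S"
    proof clarify
      fix D assume D: "D \<in> conj_classes G" "D \<subseteq> Y"
      then obtain d where d: "d \<in> carrier G" "D = conj_class G d"
        by (auto simp: conj_classes_def)
      then have "d \<in> Y" using D conj_class_self by auto
      then obtain E where E: "E \<in> S" "d \<in> E" using Y by auto
      then obtain x where x: "x \<in> carrier G" "E = conj_class G x"
        using S by (auto simp: conj_classes_def)
      then have "D = E" using conj_class_eqI[of x d] E d by simp
      then show "D \<in> S" using E by simp
    qed
  qed
  then show ?thesis by (simp add: eta_def)
qed


section \<open>Supersolvable groups\<close>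

text \<open>In contrast to \<^const>\<open>solvable_seq\<close>, every term of the series is normal in the whole group.\<close>

inductive supersolvable_seq :: "('a, 'b) monoid_scheme \<Rightarrow> 'a set \<Rightarrow> bool"
  for G where
    unity: "supersolvable_seq G {\<one>\<^bsub>G\<^esub>}"
  | extension: "\<lbrakk> supersolvable_seq G K; K \<subseteq> H; H \<lhd> G;
                  cyclic_group ((G \<lparr> carrier := H \<rparr>) Mod K) \<rbrakk> \<Longrightarrow> supersolvable_seq G H"

definition supersolvable :: "('a, 'b) monoid_scheme \<Rightarrow> bool" where
  "supersolvable G \<longleftrightarrow> supersolvable_seq G (carrier G)"


section \<open>Affine group, semidirect and wreath products\<close>

definition aff_group :: "('a, 'b) ring_scheme \<Rightarrow> ('a \<Rightarrow> 'a) monoid" where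
  "aff_group F = BijGroup (carrier F)
     \<lparr> carrier := {(\<lambda>x\<in>carrier F. (u \<otimes>\<^bsub>F\<^esub> x) \<oplus>\<^bsub>F\<^esub> v) | u v.
                     u \<in> carrier F - {\<zero>\<^bsub>F\<^esub>} \<and> v \<in> carrier F} \<rparr>"

definition semidirect ::
  "('k, 'b) monoid_scheme \<Rightarrow> ('h, 'd) monoid_scheme \<Rightarrow> ('h \<Rightarrow> 'k \<Rightarrow> 'k) \<Rightarrow> ('k \<times> 'h) monoid" where
  "semidirect K H \<phi> =
     \<lparr> carrier = carrier K \<times> carrier H,
       monoid.mult = (\<lambda>(k, h) (k', h'). (k \<otimes>\<^bsub>K\<^esub> \<phi> h k', h \<otimes>\<^bsub>H\<^esub> h')),
       one = (\<one>\<^bsub>K\<^esub>, \<one>\<^bsub>H\<^esub>) \<rparr>"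

text \<open>The left action of a group \<open>A\<close> of permutations of \<open>S\<close> on functions on \<open>S\<close>.\<close>

definition fun_action ::
  "('s \<Rightarrow> 's, 'd) monoid_scheme \<Rightarrow> 's set \<Rightarrow> ('s \<Rightarrow> 's) \<Rightarrow> ('s \<Rightarrow> 'c) \<Rightarrow> 's \<Rightarrow> 'c" where
  "fun_action A S \<alpha> f = (\<lambda>x\<in>S. f ((inv\<^bsub>A\<^esub> \<alpha>) x))"

definition wreath ::
  "('c, 'b) monoid_scheme \<Rightarrow> ('s \<Rightarrow> 's, 'd) monoid_scheme \<Rightarrow> 's set
     \<Rightarrow> (('s \<Rightarrow> 'c) \<times> ('s \<Rightarrow> 's)) monoid" where
  "wreath C A S = semidirect (product_group S (\<lambda>_. C)) A (fun_action A S)"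

text \<open>The element of the base group \<open>K\<close>, embedded in the wreath product.\<close>

definition wreath_base :: "('s \<Rightarrow> 's, 'd) monoid_scheme \<Rightarrow> ('s \<Rightarrow> 'c) \<Rightarrow> ('s \<Rightarrow> 'c) \<times> ('s \<Rightarrow> 's)" where
  "wreath_base A k = (k, \<one>\<^bsub>A\<^esub>)"

text \<open>The function on \<open>{0, \<dots>, n - 1}\<close> with the given tuple \<open>(f(0), \<dots>, f(n - 1))\<close> of values.\<close>

definition fun_of_tuple :: "'c list \<Rightarrow> int \<Rightarrow> 'c" where
  "fun_of_tuple xs = (\<lambda>i\<in>{0..int (length xs) - 1}. xs ! nat i)"

lemma group_semidirect:
  assumes K: "group K" and H: "group H"
    and closed: "\<And>h k. h \<in> carrier H \<Longrightarrow> k \<in> carrier K \<Longrightarrow> \<phi> h k \<in> carrier K"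
    and hom: "\<And>h k k'. h \<in> carrier H \<Longrightarrow> k \<in> carrier K \<Longrightarrow> k' \<in> carrier K \<Longrightarrow>
                \<phi> h (k \<otimes>\<^bsub>K\<^esub> k') = \<phi> h k \<otimes>\<^bsub>K\<^esub> \<phi> h k'"
    and act: "\<And>h h' k. h \<in> carrier H \<Longrightarrow> h' \<in> carrier H \<Longrightarrow> k \<in> carrier K \<Longrightarrow>
                \<phi> (h \<otimes>\<^bsub>H\<^esub> h') k = \<phi> h (\<phi> h' k)"
    and act_one: "\<And>k. k \<in> carrier K \<Longrightarrow> \<phi> \<one>\<^bsub>H\<^esub> k = k"
  shows "group (semidirect K H \<phi>)"
proof -
  interpret K: group K by fact
  interpret H: group H by fact
  have one: "\<phi> h \<one>\<^bsub>K\<^esub> = \<one>\<^bsub>K\<^esub>" if "h \<in> carrier H" for h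
    using hom[OF that K.one_closed K.one_closed] closed[OF that K.one_closed]
    by (metis K.l_cancel_one' K.one_closed K.r_one)
  show ?thesis
  proof (rule groupI)
    fix x assume x: "x \<in> carrier (semidirect K H \<phi>)"
    obtain k h where [simp]: "x = (k, h)" by (cases x)
    have kh: "k \<in> carrier K" "h \<in> carrier H" using x by (auto simp: semidirect_def)
    have "\<phi> (inv\<^bsub>H\<^esub> h) (inv\<^bsub>K\<^esub> k) \<otimes>\<^bsub>K\<^esub> \<phi> (inv\<^bsub>H\<^esub> h) k = \<one>\<^bsub>K\<^esub>"
      using kh hom[of "inv\<^bsub>H\<^esub> h" "inv\<^bsub>K\<^esub> k" k] one by simp
    then show "\<exists>y\<in>carrier (semidirect K H \<phi>). y \<otimes>\<^bsub>semidirect K H \<phi>\<^esub> x = \<one>\<^bsub>semidirect K H \<phi>\<^esub>"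
      using kh closed
      by (intro bexI[of _ "(\<phi> (inv\<^bsub>H\<^esub> h) (inv\<^bsub>K\<^esub> k), inv\<^bsub>H\<^esub> h)"]) (auto simp: semidirect_def)
  qed (auto simp: semidirect_def closed hom act act_one K.m_assoc H.m_assoc)
qed

lemma group_wreath:
  assumes C: "group C" and A: "subgroup A (BijGroup S)"
  shows "group (wreath C (BijGroup S \<lparr> carrier := A \<rparr>) S)"
proof -
  let ?A = "BijGroup S \<lparr> carrier := A \<rparr>"
  interpret B: group "BijGroup S" by (rule group_BijGroup)
  interpret A: group ?A using A B.group_axioms by (rule subgroup.subgroup_is_group)
  interpret C: group C by fact
  have inv_eq: "inv\<^bsub>?A\<^esub> g = inv\<^bsub>BijGroup S\<^esub> g" if "g \<in> A" for g
    using B.m_inv_consistent[OF A that] .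
  have AB: "g \<in> Bij S" if "g \<in> A" for g
    using subgroup.subset[OF A] that by (auto simp: BijGroup_def)
  have iB: "inv\<^bsub>?A\<^esub> g \<in> Bij S" if "g \<in> A" for g
    using A.inv_closed[of g] AB that by simp
  have iS: "(inv\<^bsub>?A\<^esub> g) x \<in> S" if "g \<in> A" "x \<in> S" for g x
    using Bij_imp_funcset[OF iB[OF that(1)]] that by auto
  have imult: "(inv\<^bsub>?A\<^esub> (g \<otimes>\<^bsub>?A\<^esub> h)) x = (inv\<^bsub>?A\<^esub> h) ((inv\<^bsub>?A\<^esub> g) x)"
    if "g \<in> A" "h \<in> A" "x \<in> S" for g h x
  proof -
    have "inv\<^bsub>?A\<^esub> (g \<otimes>\<^bsub>?A\<^esub> h) = inv\<^bsub>?A\<^esub> h \<otimes>\<^bsub>?A\<^esub> inv\<^bsub>?A\<^esub> g"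
      using A.inv_mult_group[of g h] that by simp
    also have "\<dots> = compose S (inv\<^bsub>?A\<^esub> h) (inv\<^bsub>?A\<^esub> g)"
      using iB that by (simp add: BijGroup_def)
    finally show ?thesis using that by (simp add: compose_def)
  qed
  show ?thesis
    unfolding wreath_def
  proof (rule group_semidirect)
    show "group (product_group S (\<lambda>_. C))" by (simp add: C)
    show "group ?A" by (rule A.group_axioms)
  next
    fix h k assume "h \<in> carrier ?A" "k \<in> carrier (product_group S (\<lambda>_. C))"
    then show "fun_action ?A S h k \<in> carrier (product_group S (\<lambda>_. C))"
      using iS by (auto simp: fun_action_def)
  next
    fix h k k' assume "h \<in> carrier ?A"
    then show "fun_action ?A S h (k \<otimes>\<^bsub>product_group S (\<lambda>_. C)\<^esub> k') =
      fun_action ?A S h k \<otimes>\<^bsub>product_group S (\<lambda>_. C)\<^esub> fun_action ?A S h k'"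
      using iS by (auto simp: fun_action_def)
  next
    fix h h' k assume "h \<in> carrier ?A" "h' \<in> carrier ?A"
    then show "fun_action ?A S (h \<otimes>\<^bsub>?A\<^esub> h') k = fun_action ?A S h (fun_action ?A S h' k)"
      using iS imult by (auto simp: fun_action_def simp del: monoid.simps partial_object.simps)
  next
    fix k assume "k \<in> carrier (product_group S (\<lambda>_. C))"
    moreover have "inv\<^bsub>?A\<^esub> \<one>\<^bsub>?A\<^esub> = (\<lambda>x\<in>S. x)"
      using A.inv_one by (simp add: BijGroup_def)
    ultimately show "fun_action ?A S \<one>\<^bsub>?A\<^esub> k = k"
      by (auto simp: fun_action_def PiE_def extensional_def)
  qed
qed

end

theory Submission
  imports Defs
begin

text \<open>
  The base group \<open>K\<close> of the wreath product is abelian, so conjugation by \<open>(f, \<alpha>)\<close> acts on \<open>K\<close> only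
  through \<open>\<alpha>\<close>, which permutes coordinates (\<open>conj_base\<close>). Write \<open>\<delta> x c\<close> for the function with value
  \<open>c\<close> at \<open>x\<close> and \<open>e\<close> elsewhere. The affine group of a field is two-transitive
  (\<open>affs_two_transitive\<close>), so the class of \<open>\<delta> 0 c\<close> consists of all \<open>\<delta> x c\<close>, one for each point \<open>x\<close>,
  and the product of this class with the class of inverses consists of all \<open>\<delta> x c \<cdot> \<delta> y c\<^sup>-\<^sup>1\<close>.
  The pairs with \<open>x = y\<close> give the identity, and the pairs with \<open>x \<noteq> y\<close> form a single orbit, which
  is the class of \<open>(c, c\<^sup>-\<^sup>1, e, \<dots>, e)\<close>. This argument (\<open>conj_class_delta_products\<close>) works over every
  two-transitive permutation group.

  Supersolvability is proved for \<open>C = \<int>/p\<close>, where \<open>K\<close> consists of the functions on the field of \<open>p\<close>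
  elements with values in that field. Let \<open>L\<^sub>d\<close> be the set of those \<open>f\<close> for which the moments
  \<open>\<Sum>x. f x \<cdot> x\<^sup>i\<close> with \<open>i < d\<close> vanish. By the binomial theorem an affine substitution turns a moment
  into a combination of moments of at most the same degree, so \<open>L\<^sub>d\<close> is normal in the wreath product
  (\<open>layer_normal\<close>); the \<open>d\<close>-th moment is a homomorphism from \<open>L\<^sub>d\<close> to \<open>\<int>/p\<close> with kernel \<open>L\<^sub>d\<^sub>+\<^sub>1\<close>
  (\<open>layer_Suc\<close>); and \<open>L\<^sub>p\<close> is trivial, because by Fermat's theorem \<open>1 - (x - y)\<^sup>p\<^sup>-\<^sup>1\<close> is the indicator
  function of \<open>y\<close> (\<open>eq_one_if_moments_vanish\<close>). Above \<open>K = L\<^sub>0\<close> the series continues with the elements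
  whose affine part \<open>x \<mapsto> u x + v\<close> has \<open>u = 1\<close>, and with the whole group; the homomorphisms for these
  two steps are \<open>v\<close>, with values in \<open>\<int>/p\<close>, and \<open>u\<close>, with values in the cyclic multiplicative group of
  the field. So every step of the series is the kernel of a homomorphism to a cyclic group, which makes
  the factors cyclic (\<open>supersolvable_seq_kernel\<close>). A bijection with a set of natural numbers finally
  carries everything over to a group on that set.
\<close>

section \<open>Cyclic quotients and supersolvable groups\<close>

text \<open>
  Division with remainder: if \<open>d\<close> is the least positive exponent with \<open>x\<^sup>d \<in> H\<close>, then \<open>x\<^sup>d\<close> generates
  \<open>H\<close>; if there is no such exponent, then \<open>H\<close> is trivial.
\<close>
lemma (in group) subgroup_of_cyclic_group:
  assumes cyc: "cyclic_group G" and H: "subgroup H G"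
  shows "cyclic_group (G\<lparr>carrier := H\<rparr>)"
proof -
  interpret H: subgroup H G by fact
  interpret GH: group "G\<lparr>carrier := H\<rparr>" using H by (rule subgroup_imp_group)
  obtain x where x: "x \<in> carrier G" and G: "carrier G = range (\<lambda>n::int. x [^] n)"
    using cyc cyclic_group by auto
  have pow: "y [^]\<^bsub>G\<lparr>carrier := H\<rparr>\<^esub> n = y [^] n" if "y \<in> H" for y and n :: int
    using int_pow_consistent[OF H that] by simp
  have powH: "y [^] n \<in> H" if "y \<in> H" for y and n :: int
    using subgroup_int_pow_closed[OF H that] .
  have "\<exists>y\<in>H. H \<subseteq> range (\<lambda>n::int. y [^] n)"
  proof (cases "\<exists>n::nat. 0 < n \<and> x [^] int n \<in> H")
    case True
    define d where "d = (LEAST n::nat. 0 < n \<and> x [^] int n \<in> H)"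
    have d: "0 < d" "x [^] int d \<in> H"
      using LeastI_ex[OF True] by (simp_all add: d_def)
    have "y \<in> range (\<lambda>n::int. (x [^] int d) [^] n)" if yH: "y \<in> H" for y
    proof -
      obtain m :: int where m: "y = x [^] m" using G H.mem_carrier[OF yH] by auto
      define q r where "q = m div int d" and "r = m mod int d"
      have qr: "m = r + int d * q" "0 \<le> r" "r < int d"
        using d by (simp_all add: q_def r_def)
      have pq: "(x [^] int d) [^] q = x [^] (int d * q)"
        using x by (simp add: int_pow_pow)
      have "x [^] r = y \<otimes> inv ((x [^] int d) [^] q)"
        using x by (simp add: m pq qr(1) int_pow_diff [symmetric])
      then have "x [^] int (nat r) \<in> H"
        using yH powH[OF d(2)] qr by auto
      moreover have "nat r < d" using qr by linarith
      ultimately have "nat r = 0"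
        using not_less_Least[of "nat r" "\<lambda>n. 0 < n \<and> x [^] int n \<in> H"]
        by (auto simp: d_def)
      then have "y = (x [^] int d) [^] q" using qr m pq by simp
      then show ?thesis by blast
    qed
    then show ?thesis using d(2) by blast
  next
    case False
    have "y = \<one>" if yH: "y \<in> H" for y
    proof -
      obtain m :: int where m: "y = x [^] m" using G H.mem_carrier[OF yH] by auto
      have xm: "x [^] int (nat \<bar>m\<bar>) \<in> H"
      proof (cases "0 \<le> m")
        case False
        then have "x [^] int (nat \<bar>m\<bar>) = inv y" using x by (simp add: m int_pow_neg)
        then show ?thesis using yH by simp
      qed (use m yH in simp)
      have "\<not> 0 < nat \<bar>m\<bar>"
      proof
        assume "0 < nat \<bar>m\<bar>"
        with xm have "\<exists>n::nat. 0 < n \<and> x [^] int n \<in> H" by (intro exI conjI)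
        with False show False ..
      qed
      then have "m = 0" by simp
      then show ?thesis using m by simp
    qed
    then have "H \<subseteq> range (\<lambda>n::int. \<one> [^] n)" by auto
    then show ?thesis using H.one_closed by blast
  qed
  then obtain y where y: "y \<in> H" "H \<subseteq> range (\<lambda>n::int. y [^] n)" by blast
  then have "H = range (\<lambda>n::int. y [^]\<^bsub>G\<lparr>carrier := H\<rparr>\<^esub> n)"
    using powH by (auto simp: pow)
  with y(1) show ?thesis unfolding GH.cyclic_group by auto
qed

text \<open>
  The quotient is isomorphic to the image of \<open>h\<close>, a subgroup of a cyclic group.
\<close>
lemma (in group_hom) cyclic_group_Mod_kernel:
  assumes "cyclic_group H"
  shows "cyclic_group (G Mod kernel G H h)"
proof -
  let ?I = "H\<lparr>carrier := h ` carrier G\<rparr>"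
  have cyc: "cyclic_group ?I"
    using H.subgroup_of_cyclic_group[OF assms img_is_subgroup] .
  have grI: "group ?I" using img_is_subgroup by (rule H.subgroup_imp_group)
  interpret I: group_hom G ?I h
    by (intro group_hom.intro group_hom_axioms.intro grI G.group_axioms) (auto simp: hom_def)
  have ker: "kernel G ?I h = kernel G H h" by (simp add: kernel_def)
  have "G Mod kernel G H h \<cong> ?I" using I.FactGroup_iso by (simp add: ker)
  moreover have "group (G Mod kernel G H h)"
    by (rule normal.factorgroup_is_group[OF normal_kernel])
  ultimately show ?thesis using isomorphic_group_cyclicity grI cyc by blast
qed

text \<open>
  The form in which a normal series is extended by one step below: instead of a quotient group one only
  has to exhibit a homomorphism to a cyclic group.
\<close>
lemma supersolvable_seq_kernel:
  assumes "group G" "group Z" "cyclic_group Z" and H: "H \<lhd> G"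
    and h: "h \<in> hom (G\<lparr>carrier := H\<rparr>) Z"
    and K: "supersolvable_seq G (kernel (G\<lparr>carrier := H\<rparr>) Z h)"
  shows "supersolvable_seq G H"
proof -
  interpret G: group G by fact
  have "group (G\<lparr>carrier := H\<rparr>)"
    using H by (simp add: G.subgroup_imp_group normal_imp_subgroup)
  then interpret h: group_hom "G\<lparr>carrier := H\<rparr>" Z h
    using assms by (simp add: group_hom_def group_hom_axioms_def)
  have "kernel (G\<lparr>carrier := H\<rparr>) Z h \<subseteq> H" by (auto simp: kernel_def)
  then show ?thesis
    using supersolvable_seq.extension[OF K _ H h.cyclic_group_Mod_kernel[OF assms(3)]] by simp
qed

lemma (in group) supersolvable_seq_normal:
  "supersolvable_seq G H \<Longrightarrow> H \<lhd> G"
  by (induction rule: supersolvable_seq.induct) (simp_all add: one_is_normal)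

text \<open>
  Take preimages of all terms of the series. For consecutive terms \<open>K \<subseteq> H\<close>, composing \<open>f\<close> with the
  projection to \<open>H/K\<close> gives a homomorphism to a cyclic group whose kernel is the preimage of \<open>K\<close>.
\<close>
lemma supersolvable_seq_vimage:
  assumes "group G" "group W" and f: "f \<in> hom G W" and inj: "inj_on f (carrier G)"
    and N: "supersolvable_seq W N"
  shows "supersolvable_seq G {x \<in> carrier G. f x \<in> N}"
  using N
proof induction
  interpret f: group_hom G W f
    using assms by (simp add: group_hom_def group_hom_axioms_def)
  case unity
  have "{x \<in> carrier G. f x \<in> {\<one>\<^bsub>W\<^esub>}} = {\<one>\<^bsub>G\<^esub>}"
    using inj by (auto dest: inj_onD[of _ _ _ "\<one>\<^bsub>G\<^esub>"])
  then show ?case using supersolvable_seq.unity[of G] by simp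
next
  interpret f: group_hom G W f
    using assms by (simp add: group_hom_def group_hom_axioms_def)
  case (extension K H)
  let ?H = "{x \<in> carrier G. f x \<in> H}" and ?W = "W\<lparr>carrier := H\<rparr>"
  interpret H: normal H W by fact
  have "K \<lhd> ?W"
    using f.H.supersolvable_seq_normal[OF extension(1)] extension(2) H.subgroup_axioms
    by (intro f.H.normal_restrict_supergroup)
  then interpret K: normal K ?W .
  have H': "?H \<lhd> G"
    by (rule f.G.normal_invI)
      (auto intro!: f.G.subgroupI simp: H.inv_op_closed2 intro: exI[of _ "\<one>\<^bsub>G\<^esub>"])
  have m: "f x \<in> carrier ?W" if "x \<in> ?H" for x using that by simp
  show ?case
  proof (rule supersolvable_seq_kernel[OF f.G.group_axioms K.factorgroup_is_group extension(4) H'])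
    show "(\<lambda>x. K #>\<^bsub>?W\<^esub> f x) \<in> hom (G\<lparr>carrier := ?H\<rparr>) (?W Mod K)"
      using K.rcos_sum[OF m m] by (auto simp: hom_def carrier_FactGroup)
    have "K #>\<^bsub>?W\<^esub> y = K \<longleftrightarrow> y \<in> K" if "y \<in> H" for y
      using that K.rcos_const[of y] f.H.subgroup_imp_group[OF H.subgroup_axioms]
        group.rcos_self[of ?W y K] K.subgroup_axioms
      by auto
    then have "kernel (G\<lparr>carrier := ?H\<rparr>) (?W Mod K) (\<lambda>x. K #>\<^bsub>?W\<^esub> f x) = {x \<in> carrier G. f x \<in> K}"
      using extension(2) by (auto simp: kernel_def)
    then show "supersolvable_seq G (kernel (G\<lparr>carrier := ?H\<rparr>) (?W Mod K) (\<lambda>x. K #>\<^bsub>?W\<^esub> f x))"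
      using extension.IH by simp
  qed
qed

lemma supersolvable_inj_hom:
  assumes "group G" "group W" "f \<in> hom G W" "inj_on f (carrier G)" "supersolvable W"
  shows "supersolvable G"
proof -
  have "{x \<in> carrier G. f x \<in> carrier W} = carrier G"
    using assms(3) by (auto simp: hom_def)
  then show ?thesis
    using supersolvable_seq_vimage[OF assms(1-4), of "carrier W"] assms(5)
    by (simp add: supersolvable_def)
qed

section \<open>Transport of structure\<close>

lemma conj_class_subset:
  "group G \<Longrightarrow> a \<in> carrier G \<Longrightarrow> conj_class G a \<subseteq> carrier G"
  by (auto simp: conj_class_def group.is_monoid monoid.m_closed group.inv_closed)

lemma iso_conj_class:
  assumes "group G" "group H" and f: "f \<in> iso G H" and a: "a \<in> carrier G"
  shows "conj_class H (f a) = f ` conj_class G a"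
proof -
  interpret group_hom G H f
    using assms by (simp add: group_hom_def group_hom_axioms_def iso_def)
  have "carrier H = f ` carrier G" using f by (auto simp: iso_def bij_betw_def)
  then have "conj_class H (f a) = {f g \<otimes>\<^bsub>H\<^esub> f a \<otimes>\<^bsub>H\<^esub> inv\<^bsub>H\<^esub> f g | g. g \<in> carrier G}"
    unfolding conj_class_def by auto
  also have "\<dots> = {f (g \<otimes>\<^bsub>G\<^esub> a \<otimes>\<^bsub>G\<^esub> inv\<^bsub>G\<^esub> g) | g. g \<in> carrier G}"
    using a by (intro Collect_cong) (metis G.inv_closed G.m_closed hom_inv hom_mult)
  also have "\<dots> = f ` conj_class G a" by (auto simp: conj_class_def)
  finally show ?thesis .
qed

lemma hom_set_mult:
  assumes "f \<in> hom G H" "X \<subseteq> carrier G" "Y \<subseteq> carrier G"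
  shows "f ` (X <#>\<^bsub>G\<^esub> Y) = f ` X <#>\<^bsub>H\<^esub> f ` Y"
proof -
  have "f (x \<otimes>\<^bsub>G\<^esub> y) = f x \<otimes>\<^bsub>H\<^esub> f y" if "x \<in> X" "y \<in> Y" for x y
    using hom_mult[OF assms(1)] assms(2,3) that by blast
  then show ?thesis by (simp add: set_mult_def image_UN)
qed

lemma inj_on_image_subset_iff:
  "inj_on f X \<Longrightarrow> D \<subseteq> X \<Longrightarrow> Y \<subseteq> X \<Longrightarrow> f ` D \<subseteq> f ` Y \<longleftrightarrow> D \<subseteq> Y"
  unfolding image_subset_iff using inj_on_image_mem_iff[of f X _ Y] by blast

lemma iso_eta:
  assumes "group G" "group H" and f: "f \<in> iso G H" and Y: "Y \<subseteq> carrier G"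
  shows "eta H (f ` Y) = eta G Y"
proof -
  have inj: "inj_on f (carrier G)" and im: "carrier H = f ` carrier G"
    using f by (auto simp: iso_def bij_betw_def)
  have sub: "D \<subseteq> carrier G" if "D \<in> conj_classes G" for D
    using that conj_class_subset[OF assms(1)] by (auto simp: conj_classes_def)
  have "conj_classes H = (`) f ` conj_classes G"
    unfolding conj_classes_def im image_image
    using iso_conj_class[OF assms(1-3)] by (rule image_cong[OF refl])
  then have "{D \<in> conj_classes H. D \<subseteq> f ` Y} = (`) f ` {D \<in> conj_classes G. D \<subseteq> Y}"
    using inj_on_image_subset_iff[OF inj] sub Y by auto
  moreover have "inj_on ((`) f) {D \<in> conj_classes G. D \<subseteq> Y}"
    using inj_on_image_eq_iff[OF inj] sub by (auto intro!: inj_onI)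
  ultimately show ?thesis by (simp add: eta_def card_image)
qed

text \<open>
  Together with \<open>supersolvable_inj_hom\<close> this moves every property of the example to an isomorphic
  group.
\<close>
lemma iso_conj_class_invariants:
  assumes "group G" "group H" and f: "f \<in> iso G H" and a: "a \<in> carrier G"
  shows "card (conj_class H (f a)) = card (conj_class G a)"
    and "eta H (conj_class H (f a) <#>\<^bsub>H\<^esub> conj_class H (inv\<^bsub>H\<^esub> f a)) =
      eta G (conj_class G a <#>\<^bsub>G\<^esub> conj_class G (inv\<^bsub>G\<^esub> a))"
proof -
  interpret group_hom G H f
    using assms by (simp add: group_hom_def group_hom_axioms_def iso_def)
  have sub: "conj_class G b \<subseteq> carrier G" if "b \<in> carrier G" for b
    using conj_class_subset[OF assms(1) that] .
  have inj: "inj_on f (carrier G)" using f by (simp add: iso_def bij_betw_def)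
  show "card (conj_class H (f a)) = card (conj_class G a)"
    by (simp add: iso_conj_class[OF assms] card_image[OF inj_on_subset[OF inj sub[OF a]]])
  have "conj_class H (f a) <#>\<^bsub>H\<^esub> conj_class H (inv\<^bsub>H\<^esub> f a) =
      f ` (conj_class G a <#>\<^bsub>G\<^esub> conj_class G (inv\<^bsub>G\<^esub> a))"
    unfolding hom_set_mult[OF homh sub[OF a] sub[OF G.inv_closed[OF a]]]
      iso_conj_class[OF assms] iso_conj_class[OF assms(1-3) G.inv_closed[OF a], symmetric] hom_inv[OF a]
    by (rule refl)
  then show "eta H (conj_class H (f a) <#>\<^bsub>H\<^esub> conj_class H (inv\<^bsub>H\<^esub> f a)) =
      eta G (conj_class G a <#>\<^bsub>G\<^esub> conj_class G (inv\<^bsub>G\<^esub> a))"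
    using iso_eta[OF assms(1-3) G.setmult_subset_G[OF sub[OF a] sub[OF G.inv_closed[OF a]]]]
    by (rule ssubst)
qed

lemma finite_group_iso_nat:
  assumes "group W" "finite (carrier W)"
  obtains G :: "nat monoid" and f where "group G" "f \<in> iso G W"
proof -
  interpret W: group W by fact
  obtain g :: "_ \<Rightarrow> nat" where g: "inj_on g (carrier W)"
    using finite_imp_inj_to_nat_seg[OF assms(2)] by (elim exE conjE)
  define f where "f = inv_into (carrier W) g"
  have fg: "f (g x) = x" if "x \<in> carrier W" for x
    using g that by (simp add: f_def)
  define G where "G = \<lparr>carrier = g ` carrier W,
    monoid.mult = (\<lambda>x y. g (f x \<otimes>\<^bsub>W\<^esub> f y)), one = g \<one>\<^bsub>W\<^esub>\<rparr>"
  have "group G"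
  proof (rule groupI)
    fix x assume "x \<in> carrier G"
    then obtain w where w: "w \<in> carrier W" "x = g w" by (auto simp: G_def)
    then show "\<exists>y\<in>carrier G. y \<otimes>\<^bsub>G\<^esub> x = \<one>\<^bsub>G\<^esub>"
      by (intro bexI[of _ "g (inv\<^bsub>W\<^esub> w)"]) (simp_all add: G_def fg)
  qed (auto simp: G_def fg W.m_assoc)
  moreover have "f \<in> iso G W"
    by (auto simp: iso_def hom_def G_def fg bij_betw_def image_image intro!: inj_onI)
  ultimately show ?thesis by (rule that)
qed

section \<open>Conjugacy classes in the base group of a wreath product\<close>

lemma (in group) conj_class_one: "conj_class G \<one> = {\<one>}"
  using one_closed by (auto simp: conj_class_def intro!: exI[of _ \<one>])

text \<open>
  Restricted to \<open>S\<close>, since the elements of a product group are extensional functions.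
\<close>
definition delta :: "('c, 'b) monoid_scheme \<Rightarrow> 's set \<Rightarrow> 's \<Rightarrow> 'c \<Rightarrow> 's \<Rightarrow> 'c" where
  "delta C S s c = (\<lambda>x\<in>S. if x = s then c else \<one>\<^bsub>C\<^esub>)"

locale abelian_wreath = C: comm_group C for C (structure) +
  fixes A :: "('s \<Rightarrow> 's) set" and S :: "'s set"
  assumes subgroup_A: "subgroup A (BijGroup S)"
begin

abbreviation "A_grp \<equiv> BijGroup S\<lparr>carrier := A\<rparr>"
abbreviation "K \<equiv> product_group S (\<lambda>_. C)"
abbreviation "W \<equiv> wreath C A_grp S"
abbreviation "act \<equiv> fun_action A_grp S"
abbreviation "base \<equiv> wreath_base A_grp"

sublocale K: group K by simp
sublocale A: group A_grp
  using group.subgroup_imp_group[OF group_BijGroup subgroup_A] .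
sublocale W: group W by (rule group_wreath[OF C.is_group subgroup_A])

lemma A_Bij: "\<alpha> \<in> A \<Longrightarrow> \<alpha> \<in> Bij S"
  using subgroup.subset[OF subgroup_A] by (auto simp: BijGroup_def)

lemma A_closed: "\<alpha> \<in> A \<Longrightarrow> x \<in> S \<Longrightarrow> \<alpha> x \<in> S"
  using Bij_imp_funcset[OF A_Bij] by blast

lemma A_mult: "\<alpha> \<in> A \<Longrightarrow> \<beta> \<in> A \<Longrightarrow> \<alpha> \<otimes>\<^bsub>BijGroup S\<^esub> \<beta> = compose S \<alpha> \<beta>"
  by (simp add: A_Bij BijGroup_def)

lemma A_inv: "\<alpha> \<in> A \<Longrightarrow> inv\<^bsub>A_grp\<^esub> \<alpha> = (\<lambda>x\<in>S. inv_into S \<alpha> x)"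
  using group.m_inv_consistent[OF group_BijGroup subgroup_A] by (simp add: inv_BijGroup A_Bij)

lemma bij_A: "\<alpha> \<in> A \<Longrightarrow> bij_betw \<alpha> S S"
  using A_Bij by (simp add: Bij_def)

lemma carrier_W: "carrier W = carrier K \<times> A"
  by (simp add: wreath_def semidirect_def)

lemma mult_W: "(f, \<alpha>) \<otimes>\<^bsub>W\<^esub> (g, \<beta>) = (f \<otimes>\<^bsub>K\<^esub> act \<alpha> g, \<alpha> \<otimes>\<^bsub>BijGroup S\<^esub> \<beta>)"
  by (simp add: wreath_def semidirect_def)

lemma one_W: "\<one>\<^bsub>W\<^esub> = base \<one>\<^bsub>K\<^esub>"
  by (simp add: wreath_def semidirect_def wreath_base_def)

lemma act_apply: "\<alpha> \<in> A \<Longrightarrow> x \<in> S \<Longrightarrow> act \<alpha> f (\<alpha> x) = f x"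
  using bij_A[of \<alpha>] A_closed
  by (simp add: fun_action_def A_inv bij_betw_inv_into_left)

text \<open>
  \<^const>\<open>fun_action\<close> is defined with the inverse permutation. Evaluating at points of the form \<open>\<alpha> x\<close>
  characterises it without any inverse, and all computations with \<open>act\<close> go through this rule.
\<close>
lemma act_eqI:
  assumes "\<alpha> \<in> A" "g \<in> extensional S" "\<And>x. x \<in> S \<Longrightarrow> g (\<alpha> x) = f x"
  shows "act \<alpha> f = g"
proof (rule extensionalityI[of _ S])
  fix y assume "y \<in> S"
  then obtain x where "x \<in> S" "y = \<alpha> x" using bij_A[OF assms(1)] by (auto simp: bij_betw_def)
  then show "act \<alpha> f y = g y" using assms act_apply by simp
qed (use assms in \<open>auto simp: fun_action_def\<close>)

lemma act_closed: "\<alpha> \<in> A \<Longrightarrow> f \<in> carrier K \<Longrightarrow> act \<alpha> f \<in> carrier K"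
  using bij_A[of \<alpha>] bij_betw_inv_into[of \<alpha> S S]
  by (auto simp: fun_action_def A_inv bij_betw_def)

lemma act_one: "f \<in> carrier K \<Longrightarrow> act \<one>\<^bsub>A_grp\<^esub> f = f"
  using A.one_closed by (intro act_eqI) (auto simp: BijGroup_def PiE_def)

lemma act_mult: "\<alpha> \<in> A \<Longrightarrow> act \<alpha> (f \<otimes>\<^bsub>K\<^esub> g) = act \<alpha> f \<otimes>\<^bsub>K\<^esub> act \<alpha> g"
  by (rule act_eqI) (auto simp: act_apply A_closed)

lemma base_closed: "f \<in> carrier K \<Longrightarrow> base f \<in> carrier W"
  using A.one_closed by (simp add: carrier_W wreath_base_def)

lemma base_mult: "f \<in> carrier K \<Longrightarrow> g \<in> carrier K \<Longrightarrow> base f \<otimes>\<^bsub>W\<^esub> base g = base (f \<otimes>\<^bsub>K\<^esub> g)"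
  using A.r_one[OF A.one_closed] act_one[of g] by (simp add: wreath_base_def mult_W)

lemma inv_base:
  assumes "f \<in> carrier K"
  shows "inv\<^bsub>W\<^esub> base f = base (inv\<^bsub>K\<^esub> f)"
  using assms by (intro W.inv_equality) (simp_all only: base_closed base_mult K.inv_closed K.l_inv one_W)

text \<open>
  As \<open>K\<close> is abelian, \<open>(f, \<alpha>) \<cdot> k = f \<cdot> act \<alpha> k \<cdot> \<alpha> = act \<alpha> k \<cdot> (f, \<alpha>)\<close>: the factor \<open>f\<close> has no effect.
\<close>
lemma conj_base:
  assumes g: "(f, \<alpha>) \<in> carrier W" and k: "k \<in> carrier K"
  shows "(f, \<alpha>) \<otimes>\<^bsub>W\<^esub> base k \<otimes>\<^bsub>W\<^esub> inv\<^bsub>W\<^esub> (f, \<alpha>) = base (act \<alpha> k)"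
proof -
  have f: "f \<in> carrier K" "\<alpha> \<in> A" using g by (simp_all add: carrier_W)
  note ak = act_closed[OF f(2) k]
  have "f \<otimes>\<^bsub>K\<^esub> act \<alpha> k = act \<alpha> k \<otimes>\<^bsub>K\<^esub> f"
    using f ak by (auto simp: PiE_iff intro!: restrict_ext C.m_comm)
  then have "(f, \<alpha>) \<otimes>\<^bsub>W\<^esub> base k = base (act \<alpha> k) \<otimes>\<^bsub>W\<^esub> (f, \<alpha>)"
    using f A.r_one[of \<alpha>] A.l_one[of \<alpha>] act_one[of f] by (simp add: wreath_base_def mult_W)
  then show ?thesis
    using g base_closed[OF k] base_closed[OF ak] W.inv_solve_right' by auto
qed

lemma conj_class_base:
  assumes "k \<in> carrier K"
  shows "conj_class W (base k) = base ` (\<lambda>\<alpha>. act \<alpha> k) ` A"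
proof -
  have "conj_class W (base k) = (\<lambda>g. g \<otimes>\<^bsub>W\<^esub> base k \<otimes>\<^bsub>W\<^esub> inv\<^bsub>W\<^esub> g) ` (carrier K \<times> A)"
    unfolding conj_class_def carrier_W by blast
  also have "\<dots> = (\<lambda>g. base (act (snd g) k)) ` (carrier K \<times> A)"
    using conj_base[OF _ assms] unfolding carrier_W by (intro image_cong refl) auto
  also have "\<dots> = base ` (\<lambda>\<alpha>. act \<alpha> k) ` snd ` (carrier K \<times> A)"
    unfolding image_image by (rule refl)
  also have "snd ` (carrier K \<times> A) = A"
    using K.one_closed by (auto simp only: snd_image_times split: if_splits)
  finally show ?thesis .
qed

abbreviation "\<delta> \<equiv> delta C S"

lemma delta_closed: "c \<in> carrier C \<Longrightarrow> \<delta> s c \<in> carrier K"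
  by (auto simp: delta_def)

lemma act_delta: "\<alpha> \<in> A \<Longrightarrow> s \<in> S \<Longrightarrow> act \<alpha> (\<delta> s c) = \<delta> (\<alpha> s) c"
  using bij_A[of \<alpha>]
  by (intro act_eqI) (auto simp: delta_def A_closed bij_betw_def inj_on_eq_iff)

lemma inv_delta: "c \<in> carrier C \<Longrightarrow> inv\<^bsub>K\<^esub> \<delta> s c = \<delta> s (inv c)"
  using delta_closed[of c s] by (subst inv_product_group) (auto simp: delta_def)

end

locale two_transitive_wreath = abelian_wreath +
  assumes two_transitive:
    "\<lbrakk>s \<in> S; t \<in> S; s \<noteq> t; s' \<in> S; t' \<in> S; s' \<noteq> t'\<rbrakk> \<Longrightarrow> \<exists>\<alpha>\<in>A. \<alpha> s = s' \<and> \<alpha> t = t'"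
begin

text \<open>
  The point \<open>t\<close> guarantees that there are at least two points, without which two-transitivity would not
  imply transitivity.
\<close>
lemma conj_class_delta:
  assumes s: "s \<in> S" and t: "t \<in> S" "s \<noteq> t" and c: "c \<in> carrier C"
  shows "conj_class W (base (\<delta> s c)) = base ` (\<lambda>x. \<delta> x c) ` S"
proof -
  have "S \<subseteq> (\<lambda>\<alpha>. \<alpha> s) ` A"
  proof
    fix x assume x: "x \<in> S"
    obtain y where "y \<in> S" "y \<noteq> x" using s t by metis
    then show "x \<in> (\<lambda>\<alpha>. \<alpha> s) ` A" using two_transitive[OF s t x] by force
  qed
  then have "(\<lambda>\<alpha>. \<alpha> s) ` A = S" using s A_closed by auto
  then have "(\<lambda>\<alpha>. act \<alpha> (\<delta> s c)) ` A = (\<lambda>x. \<delta> x c) ` S"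
    using s by (auto simp: act_delta image_image [symmetric] cong: image_cong_simp)
  then show ?thesis unfolding conj_class_base[OF delta_closed[OF c]] by (rule arg_cong)
qed

lemma conj_class_delta_pair:
  assumes s: "s \<in> S" and t: "t \<in> S" "s \<noteq> t" and c: "c \<in> carrier C" "d \<in> carrier C"
  shows "conj_class W (base (\<delta> s c \<otimes>\<^bsub>K\<^esub> \<delta> t d)) =
    {base (\<delta> x c \<otimes>\<^bsub>K\<^esub> \<delta> y d) | x y. x \<in> S \<and> y \<in> S \<and> x \<noteq> y}" (is "_ = ?R")
proof -
  have "base (act \<alpha> (\<delta> s c \<otimes>\<^bsub>K\<^esub> \<delta> t d)) = base (\<delta> (\<alpha> s) c \<otimes>\<^bsub>K\<^esub> \<delta> (\<alpha> t) d)"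
    if "\<alpha> \<in> A" for \<alpha>
    unfolding act_mult[OF that] act_delta[OF that s] act_delta[OF that t(1)] by (rule refl)
  then have "base ` (\<lambda>\<alpha>. act \<alpha> (\<delta> s c \<otimes>\<^bsub>K\<^esub> \<delta> t d)) ` A =
      (\<lambda>\<alpha>. base (\<delta> (\<alpha> s) c \<otimes>\<^bsub>K\<^esub> \<delta> (\<alpha> t) d)) ` A"
    unfolding image_image by (rule image_cong[OF refl])
  also have "\<dots> = ?R"
  proof (intro equalityI subsetI)
    fix z assume "z \<in> (\<lambda>\<alpha>. base (\<delta> (\<alpha> s) c \<otimes>\<^bsub>K\<^esub> \<delta> (\<alpha> t) d)) ` A"
    then obtain \<alpha> where a: "\<alpha> \<in> A" "z = base (\<delta> (\<alpha> s) c \<otimes>\<^bsub>K\<^esub> \<delta> (\<alpha> t) d)" by blast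
    moreover have "\<alpha> s \<noteq> \<alpha> t"
      using bij_A[OF a(1)] s t by (auto simp: bij_betw_def inj_on_eq_iff)
    ultimately show "z \<in> ?R" using s t A_closed by blast
  next
    fix z assume "z \<in> ?R"
    then obtain x y where "z = base (\<delta> x c \<otimes>\<^bsub>K\<^esub> \<delta> y d)" "x \<in> S" "y \<in> S" "x \<noteq> y" by blast
    with two_transitive[OF s t, of x y]
    show "z \<in> (\<lambda>\<alpha>. base (\<delta> (\<alpha> s) c \<otimes>\<^bsub>K\<^esub> \<delta> (\<alpha> t) d)) ` A" by auto
  qed
  finally show ?thesis
    unfolding conj_class_base[OF K.m_closed[OF delta_closed[OF c(1)] delta_closed[OF c(2)]]] .
qed

text \<open>
  The product of the two classes is indexed by all pairs \<open>(x, y)\<close>. The diagonal contributes the identity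
  and the rest is one orbit by two-transitivity; the two classes differ because the value at \<open>s\<close> of the
  representative of the second is \<open>c \<noteq> \<one>\<close>.
\<close>
theorem conj_class_delta_products:
  assumes s: "s \<in> S" and t: "t \<in> S" "s \<noteq> t" and c: "c \<in> carrier C" "c \<noteq> \<one>"
  defines "a \<equiv> base (\<delta> s c)"
  shows "card (conj_class W a) = card S"
    and "conj_class W a <#>\<^bsub>W\<^esub> conj_class W (inv\<^bsub>W\<^esub> a) =
      conj_class W (base \<one>\<^bsub>K\<^esub>) \<union> conj_class W (base (\<delta> s c \<otimes>\<^bsub>K\<^esub> \<delta> t (inv c)))"
    and "eta W (conj_class W a <#>\<^bsub>W\<^esub> conj_class W (inv\<^bsub>W\<^esub> a)) = 2"
proof -
  let ?b = "base (\<delta> s c \<otimes>\<^bsub>K\<^esub> \<delta> t (inv c))"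
  have ic: "inv c \<in> carrier C" using c by simp
  have inv_a: "inv\<^bsub>W\<^esub> a = base (\<delta> s (inv c))"
    unfolding a_def inv_base[OF delta_closed[OF c(1)]] inv_delta[OF c(1)] ..
  note cla = conj_class_delta[OF s t c(1), folded a_def]
  note clia = conj_class_delta[OF s t ic, folded inv_a]
  have inj_delta: "inj_on (\<lambda>x. \<delta> x c) S"
  proof
    fix x y assume "x \<in> S" "y \<in> S" "\<delta> x c = \<delta> y c"
    then have "\<delta> x c x = \<delta> y c x" by simp
    then show "x = y" using \<open>x \<in> S\<close> c by (auto simp: delta_def split: if_splits)
  qed
  have "inj_on base ((\<lambda>x. \<delta> x c) ` S)" by (auto simp: inj_on_def wreath_base_def)
  then show "card (conj_class W a) = card S"
    unfolding cla by (simp only: card_image inj_delta)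
  have one: "conj_class W (base \<one>\<^bsub>K\<^esub>) = {base \<one>\<^bsub>K\<^esub>}"
    unfolding one_W [symmetric] by (rule W.conj_class_one)
  have diag: "\<delta> x c \<otimes>\<^bsub>K\<^esub> \<delta> x (inv c) = \<one>\<^bsub>K\<^esub>" for x
    using c by (auto simp: delta_def)
  have "conj_class W a <#>\<^bsub>W\<^esub> conj_class W (inv\<^bsub>W\<^esub> a) =
      {base (\<delta> x c) \<otimes>\<^bsub>W\<^esub> base (\<delta> y (inv c)) | x y. x \<in> S \<and> y \<in> S}"
    unfolding cla clia set_mult_def by blast
  also have "\<dots> = {base (\<delta> x c \<otimes>\<^bsub>K\<^esub> \<delta> y (inv c)) | x y. x \<in> S \<and> y \<in> S}"
    unfolding base_mult[OF delta_closed[OF c(1)] delta_closed[OF ic]] by (rule refl)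
  also have "\<dots> = {base \<one>\<^bsub>K\<^esub>} \<union>
      {base (\<delta> x c \<otimes>\<^bsub>K\<^esub> \<delta> y (inv c)) | x y. x \<in> S \<and> y \<in> S \<and> x \<noteq> y}"
    (is "?L = ?R")
  proof (intro equalityI subsetI)
    fix z assume "z \<in> ?L"
    then obtain x y where z: "z = base (\<delta> x c \<otimes>\<^bsub>K\<^esub> \<delta> y (inv c))" "x \<in> S" "y \<in> S" by blast
    show "z \<in> ?R"
    proof (cases "x = y")
      case True
      then show ?thesis unfolding z(1) by (simp only: diag) (rule UnI1[OF singletonI])
    next
      case False
      with z show ?thesis by (intro UnI2) blast
    qed
  next
    fix z assume "z \<in> ?R"
    then show "z \<in> ?L"
    proof
      assume "z \<in> {base \<one>\<^bsub>K\<^esub>}"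
      then have "z = base (\<delta> s c \<otimes>\<^bsub>K\<^esub> \<delta> s (inv c))" by (simp only: diag singleton_iff)
      with s show ?thesis by blast
    qed blast
  qed
  finally show prod: "conj_class W a <#>\<^bsub>W\<^esub> conj_class W (inv\<^bsub>W\<^esub> a) =
      conj_class W (base \<one>\<^bsub>K\<^esub>) \<union> conj_class W ?b"
    unfolding one conj_class_delta_pair[OF s t c(1) ic] .
  have bW: "?b \<in> carrier W" "base \<one>\<^bsub>K\<^esub> \<in> carrier W"
    by (intro base_closed K.m_closed delta_closed c ic K.one_closed)+
  have "(\<delta> s c \<otimes>\<^bsub>K\<^esub> \<delta> t (inv c)) s \<noteq> \<one>\<^bsub>K\<^esub> s"
    using s t c by (auto simp: delta_def)
  then have "?b \<notin> conj_class W (base \<one>\<^bsub>K\<^esub>)"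
    unfolding one by (auto simp: wreath_base_def simp del: mult_product_group one_product_group)
  then have "conj_class W (base \<one>\<^bsub>K\<^esub>) \<noteq> conj_class W ?b"
    using W.conj_class_self[OF bW(1)] by auto
  then have card2: "card {conj_class W (base \<one>\<^bsub>K\<^esub>), conj_class W ?b} = 2"
    unfolding card_2_iff by blast
  have "{conj_class W (base \<one>\<^bsub>K\<^esub>), conj_class W ?b} \<subseteq> conj_classes W"
    using bW unfolding conj_classes_def by blast
  from W.eta_eqI[OF this refl] show "eta W (conj_class W a <#>\<^bsub>W\<^esub> conj_class W (inv\<^bsub>W\<^esub> a)) = 2"
    unfolding prod by (simp only: card2 Union_insert Union_empty Un_empty_right)
qed

end

section \<open>The affine group of a field\<close>

context field
begin

definition aff :: "'a \<Rightarrow> 'a \<Rightarrow> 'a \<Rightarrow> 'a" where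
  "aff u v = (\<lambda>x\<in>carrier R. u \<otimes> x \<oplus> v)"

definition affs :: "('a \<Rightarrow> 'a) set" where
  "affs = {aff u v | u v. u \<in> carrier R - {\<zero>} \<and> v \<in> carrier R}"

lemma affsI: "u \<in> carrier R - {\<zero>} \<Longrightarrow> v \<in> carrier R \<Longrightarrow> aff u v \<in> affs"
  unfolding affs_def by blast

lemma affsE:
  assumes "\<alpha> \<in> affs"
  obtains u v where "\<alpha> = aff u v" "u \<in> carrier R - {\<zero>}" "v \<in> carrier R"
  using assms unfolding affs_def by blast

lemma aff_group_eq: "aff_group R = BijGroup (carrier R)\<lparr>carrier := affs\<rparr>"
  by (simp add: aff_group_def affs_def aff_def)

lemma inv_nonzero: "u \<in> carrier R - {\<zero>} \<Longrightarrow> inv u \<in> carrier R - {\<zero>}"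
  using Units_inv_Units[of u] by (simp add: field_Units)

lemma mult_nonzero: "u \<in> carrier R - {\<zero>} \<Longrightarrow> v \<in> carrier R - {\<zero>} \<Longrightarrow> u \<otimes> v \<in> carrier R - {\<zero>}"
  by (auto simp: integral_iff)

lemma inv_mult_cancel:
  assumes "u \<in> carrier R - {\<zero>}" "x \<in> carrier R"
  shows "inv u \<otimes> (u \<otimes> x) = x" "u \<otimes> (inv u \<otimes> x) = x"
  using assms Units_l_inv[of u] Units_r_inv[of u] inv_nonzero[of u]
  by (auto simp: field_Units simp flip: m_assoc)

lemma aff_apply [simp]: "x \<in> carrier R \<Longrightarrow> aff u v x = u \<otimes> x \<oplus> v"
  by (simp add: aff_def)

lemma compose_aff:
  assumes "u \<in> carrier R" "v \<in> carrier R" "u' \<in> carrier R" "v' \<in> carrier R"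
  shows "compose (carrier R) (aff u v) (aff u' v') = aff (u \<otimes> u') (u \<otimes> v' \<oplus> v)"
  by (rule extensionalityI[of _ "carrier R"])
    (use assms in \<open>auto simp: compose_def aff_def r_distr m_assoc a_assoc\<close>)

lemma aff_one: "aff \<one> \<zero> = (\<lambda>x\<in>carrier R. x)"
  by (auto simp: aff_def intro: restrict_ext)

lemma aff_inverse:
  assumes "u \<in> carrier R - {\<zero>}" "v \<in> carrier R"
  shows "compose (carrier R) (aff (inv u) (\<ominus> (inv u \<otimes> v))) (aff u v) = (\<lambda>x\<in>carrier R. x)"
    and "compose (carrier R) (aff u v) (aff (inv u) (\<ominus> (inv u \<otimes> v))) = (\<lambda>x\<in>carrier R. x)"
proof -
  note iu = inv_nonzero[OF assms(1)]
  have one: "inv u \<otimes> u = \<one>" "u \<otimes> inv u = \<one>"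
    using inv_mult_cancel[OF assms(1), of \<one>] assms iu by auto
  have "u \<otimes> \<ominus> (inv u \<otimes> v) \<oplus> v = \<zero>"
    using assms iu inv_mult_cancel[OF assms] by (simp add: r_minus l_neg)
  then show "compose (carrier R) (aff (inv u) (\<ominus> (inv u \<otimes> v))) (aff u v) = (\<lambda>x\<in>carrier R. x)"
    and "compose (carrier R) (aff u v) (aff (inv u) (\<ominus> (inv u \<otimes> v))) = (\<lambda>x\<in>carrier R. x)"
    using assms iu one by (simp_all add: compose_aff r_neg aff_one)
qed

lemma aff_Bij:
  assumes "u \<in> carrier R - {\<zero>}" "v \<in> carrier R"
  shows "aff u v \<in> Bij (carrier R)"
proof -
  let ?g = "aff (inv u) (\<ominus> (inv u \<otimes> v))"
  note iu = inv_nonzero[OF assms(1)]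
  have "bij_betw (aff u v) (carrier R) (carrier R)"
  proof (rule bij_betw_byWitness[where f' = ?g])
    show "\<forall>x\<in>carrier R. ?g (aff u v x) = x"
      using aff_inverse(1)[OF assms] by (metis compose_eq restrict_apply')
    show "\<forall>x\<in>carrier R. aff u v (?g x) = x"
      using aff_inverse(2)[OF assms] by (metis compose_eq restrict_apply')
    show "aff u v ` carrier R \<subseteq> carrier R" using assms by auto
    show "?g ` carrier R \<subseteq> carrier R" using assms iu by auto
  qed
  then show ?thesis by (simp add: Bij_def aff_def)
qed

lemma subgroup_affs: "subgroup affs (BijGroup (carrier R))"
proof (rule group.subgroupI[OF group_BijGroup])
  show "affs \<subseteq> carrier (BijGroup (carrier R))"
    using aff_Bij by (auto simp: affs_def BijGroup_def)
  show "affs \<noteq> {}" using affsI[of \<one> \<zero>] by auto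
  fix f assume "f \<in> affs"
  then obtain u v where f: "u \<in> carrier R - {\<zero>}" "v \<in> carrier R" "f = aff u v"
    by (rule affsE) blast
  let ?g = "aff (inv u) (\<ominus> (inv u \<otimes> v))"
  have g: "inv u \<in> carrier R - {\<zero>}" "\<ominus> (inv u \<otimes> v) \<in> carrier R"
    using inv_nonzero[OF f(1)] f(2) by auto
  have "inv\<^bsub>BijGroup (carrier R)\<^esub> f = ?g"
    using aff_inverse(1)[OF f(1,2)] aff_Bij[OF f(1,2)] aff_Bij[OF g] f(3)
    by (intro group.inv_equality[OF group_BijGroup]) (simp_all add: BijGroup_def)
  then show "inv\<^bsub>BijGroup (carrier R)\<^esub> f \<in> affs" using affsI[OF g] by simp
  fix h assume "h \<in> affs"
  then obtain u' v' where h: "u' \<in> carrier R - {\<zero>}" "v' \<in> carrier R" "h = aff u' v'"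
    by (rule affsE) blast
  have "f \<otimes>\<^bsub>BijGroup (carrier R)\<^esub> h = aff (u \<otimes> u') (u \<otimes> v' \<oplus> v)"
    using f h aff_Bij[OF f(1,2)] aff_Bij[OF h(1,2)] by (simp add: BijGroup_def compose_aff)
  then show "f \<otimes>\<^bsub>BijGroup (carrier R)\<^esub> h \<in> affs"
    using affsI[OF mult_nonzero[OF f(1) h(1)], of "u \<otimes> v' \<oplus> v"] f h by simp
qed

text \<open>
  Two linear equations for \<open>u\<close> and \<open>v\<close>: subtracting them gives \<open>u = (s' - t') / (s - t)\<close>, and then
  \<open>v = s' - u s\<close>.
\<close>
lemma affs_two_transitive:
  assumes st: "s \<in> carrier R" "t \<in> carrier R" "s \<noteq> t"
    and st': "s' \<in> carrier R" "t' \<in> carrier R" "s' \<noteq> t'"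
  shows "\<exists>\<alpha>\<in>affs. \<alpha> s = s' \<and> \<alpha> t = t'"
proof -
  have nz: "s \<ominus> t \<in> carrier R - {\<zero>}" "s' \<ominus> t' \<in> carrier R - {\<zero>}"
    using st st' by auto
  define u where "u = inv (s \<ominus> t) \<otimes> (s' \<ominus> t')"
  define v where "v = s' \<ominus> u \<otimes> s"
  have u: "u \<in> carrier R - {\<zero>}"
    unfolding u_def by (rule mult_nonzero[OF inv_nonzero[OF nz(1)] nz(2)])
  then have uc: "u \<in> carrier R" by simp
  have v: "v \<in> carrier R" using uc st st' by (simp add: v_def)
  have d: "(s \<ominus> t) \<otimes> u = s' \<ominus> t'"
    unfolding u_def using inv_mult_cancel(2)[OF nz(1)] nz(2) by simp
  have "u \<otimes> s \<oplus> v = s'"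
    unfolding v_def using uc st st' by algebra
  moreover have "u \<otimes> t \<oplus> v = s' \<ominus> (s \<ominus> t) \<otimes> u"
    unfolding v_def using uc st st' by algebra
  then have "u \<otimes> t \<oplus> v = t'"
    unfolding d using st' by algebra
  moreover have "aff u v \<in> affs" using u v by (rule affsI)
  ultimately show ?thesis using st by (intro bexI[of _ "aff u v"]) auto
qed

end

section \<open>Supersolvability of the affine wreath product\<close>

lemma (in residues_prime) cyclic_mult_of: "cyclic_group (mult_of R)"
proof -
  interpret M: group "mult_of R" by (rule field_mult_group)
  obtain a where a: "a \<in> carrier (mult_of R)"
      "carrier (mult_of R) = {a [^] i | i::nat. i \<in> UNIV}"
    using finite_field_mult_group_has_gen[OF finite] by blast
  have "carrier (mult_of R) \<subseteq> range (\<lambda>n::int. a [^]\<^bsub>mult_of R\<^esub> n)"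
  proof
    fix x assume "x \<in> carrier (mult_of R)"
    then obtain i :: nat where "x = a [^] i" using a(2) by blast
    then have "x = a [^]\<^bsub>mult_of R\<^esub> int i" by (simp only: int_pow_int nat_pow_mult_of)
    then show "x \<in> range (\<lambda>n::int. a [^]\<^bsub>mult_of R\<^esub> n)" by (rule range_eqI)
  qed
  moreover have "range (\<lambda>n::int. a [^]\<^bsub>mult_of R\<^esub> n) \<subseteq> carrier (mult_of R)"
    using M.int_pow_closed[OF a(1)] by blast
  ultimately show ?thesis using a(1) M.cyclic_group by blast
qed

lemma cyclic_integer_mod_group:
  assumes "n > 1"
  shows "cyclic_group (integer_mod_group n)"
proof -
  have "carrier (integer_mod_group n) = range (\<lambda>m::int. 1 [^]\<^bsub>integer_mod_group n\<^esub> m)"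
    using assms
    by (auto simp: int_pow_integer_mod_group carrier_integer_mod_group image_iff
        intro!: exI mod_pos_pos_trivial [symmetric])
  moreover have "1 \<in> carrier (integer_mod_group n)" using assms by simp
  ultimately show ?thesis
    using group.cyclic_group[OF group_integer_mod_group] by blast
qed

context residues_prime
begin

abbreviation "Z \<equiv> integer_mod_group p"

sublocale AW: two_transitive_wreath Z affs "carrier R"
  by (intro two_transitive_wreath.intro two_transitive_wreath_axioms.intro
      abelian_wreath.intro abelian_wreath_axioms.intro abelian_integer_mod_group
      subgroup_affs affs_two_transitive)

lemma p_gt_1: "p > 1" using m_gt_one by simp

lemma carrier_Z: "carrier Z = carrier R"
  using p_gt_1 by (auto simp: carrier_integer_mod_group res_carrier_eq)

text \<open>
  An integer rather than a residue class, so that the binomial theorem for integers applies; only its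
  class modulo \<open>p\<close> matters.
\<close>
definition moment :: "nat \<Rightarrow> (int \<Rightarrow> int) \<Rightarrow> int" where
  "moment d f = (\<Sum>x\<in>carrier R. f x * x ^ d)"

lemma moment_mult: "[moment d (f \<otimes>\<^bsub>AW.K\<^esub> g) = moment d f + moment d g] (mod p)"
proof -
  have "moment d f + moment d g = (\<Sum>x\<in>carrier R. (f x + g x) * x ^ d)"
    by (simp add: moment_def sum.distrib distrib_right)
  moreover have "[moment d (f \<otimes>\<^bsub>AW.K\<^esub> g) = (\<Sum>x\<in>carrier R. (f x + g x) * x ^ d)] (mod p)"
    unfolding moment_def by (intro cong_sum cong_mult) (auto simp: cong_def)
  ultimately show ?thesis by simp
qed

lemma moment_one: "moment d \<one>\<^bsub>AW.K\<^esub> = 0"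
  by (simp add: moment_def)

text \<open>
  Expanding \<open>(u x + v)\<^sup>i\<close> turns the sum into a combination of the moments of degree at most \<open>i\<close>. The
  case of a unit \<open>u\<close> gives the invariance of the layers under the affine group, and \<open>u = 1\<close>, \<open>v = - y\<close>
  gives the separation of points in \<open>eq_one_if_moments_vanish\<close>.
\<close>
lemma dvd_sum_affine_power:
  assumes "\<And>j. j \<le> i \<Longrightarrow> int p dvd moment j f"
  shows "int p dvd (\<Sum>x\<in>carrier R. f x * (u * x + v) ^ i)"
proof -
  have "(\<Sum>x\<in>carrier R. f x * (u * x + v) ^ i) =
      (\<Sum>x\<in>carrier R. \<Sum>j\<le>i. f x * (of_nat (i choose j) * (u * x) ^ j * v ^ (i - j)))"
    by (simp add: binomial_ring sum_distrib_left)
  also have "\<dots> = (\<Sum>j\<le>i. \<Sum>x\<in>carrier R. f x * (of_nat (i choose j) * (u * x) ^ j * v ^ (i - j)))"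
    by (rule sum.swap)
  also have "\<dots> = (\<Sum>j\<le>i. of_nat (i choose j) * u ^ j * v ^ (i - j) * moment j f)"
    unfolding moment_def by (simp add: sum_distrib_left power_mult_distrib algebra_simps)
  finally show ?thesis using assms by (auto intro!: dvd_sum)
qed

lemma moment_act:
  assumes "\<alpha> \<in> affs" "\<And>j. j \<le> i \<Longrightarrow> int p dvd moment j f"
  shows "int p dvd moment i (AW.act \<alpha> f)"
proof -
  obtain u v where uv: "\<alpha> = aff u v" using assms(1) by (auto simp: affs_def)
  have "moment i (AW.act \<alpha> f) = (\<Sum>x\<in>carrier R. AW.act \<alpha> f (\<alpha> x) * \<alpha> x ^ i)"
    unfolding moment_def
    by (rule sum.reindex_bij_betw[OF AW.bij_A[OF assms(1)], symmetric])
  also have "\<dots> = (\<Sum>x\<in>carrier R. f x * \<alpha> x ^ i)"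
    by (rule sum.cong[OF refl]) (simp only: AW.act_apply[OF assms(1)])
  also have "[\<dots> = (\<Sum>x\<in>carrier R. f x * (u * x + v) ^ i)] (mod p)"
    by (intro cong_sum cong_mult cong_refl cong_pow)
      (auto simp: uv res_add_eq res_mult_eq cong_def mod_simps)
  finally show ?thesis
    using dvd_sum_affine_power[OF assms(2)] by (simp only: cong_dvd_iff)
qed

lemma fermat_int:
  assumes "\<not> int p dvd a"
  shows "[a ^ (p - 1) = 1] (mod int p)"
proof -
  have "\<not> p dvd nat (a mod p)"
    using assms p_gt_1 by (metis dvd_mod_iff dvd_refl int_dvd_int_iff int_nat_eq pos_mod_sign of_nat_0_less_iff zero_less_one less_trans)
  then have "[nat (a mod p) ^ (p - 1) = 1] (mod p)" by (rule fermat_theorem[OF p_prime])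
  then have "[int (nat (a mod p) ^ (p - 1)) = int 1] (mod int p)" by (simp only: cong_int_iff)
  then have "[(a mod p) ^ (p - 1) = 1] (mod int p)" using p_gt_1 by simp
  then show ?thesis by (simp add: cong_def mod_simps)
qed

text \<open>
  The sum of \<open>f x \<cdot> (x - y)\<^sup>p\<^sup>-\<^sup>1\<close> over all \<open>x\<close> is a combination of moments, hence zero modulo \<open>p\<close>, and by Fermat's
  theorem it is the sum of \<open>f x\<close> over \<open>x \<noteq> y\<close>. Comparison with the moment of degree \<open>0\<close> leaves
  \<open>f y \<equiv> 0\<close>, and the values of \<open>f\<close> are reduced.
\<close>
lemma eq_one_if_moments_vanish:
  assumes f: "f \<in> carrier AW.K" and M: "\<And>j. j < p \<Longrightarrow> int p dvd moment j f"
  shows "f = \<one>\<^bsub>AW.K\<^esub>"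
proof (rule extensionalityI[of _ "carrier R"])
  fix y assume y: "y \<in> carrier R"
  have "int p dvd (\<Sum>x\<in>carrier R. f x * (1 * x + (- y)) ^ (p - 1))"
    using M p_gt_1 by (intro dvd_sum_affine_power) auto
  also have "(\<Sum>x\<in>carrier R. f x * (1 * x + (- y)) ^ (p - 1)) =
      (\<Sum>x\<in>carrier R - {y}. f x * (x - y) ^ (p - 1))"
    \<comment> \<open>the exponent \<open>p - 1\<close> is positive, so the term at \<open>x = y\<close> is zero\<close>
    using y p_gt_1 by (subst sum.remove[OF finite y]) simp
  finally have 1: "int p dvd (\<Sum>x\<in>carrier R - {y}. f x * (x - y) ^ (p - 1))" .
  have "[(\<Sum>x\<in>carrier R - {y}. f x * (x - y) ^ (p - 1)) = (\<Sum>x\<in>carrier R - {y}. f x * 1)] (mod int p)"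
  proof (intro cong_sum cong_mult cong_refl fermat_int)
    fix x assume x: "x \<in> carrier R - {y}"
    then have "\<bar>x - y\<bar> < int p" "x - y \<noteq> 0" using y by (auto simp: res_carrier_eq)
    then show "\<not> int p dvd x - y" using dvd_imp_le_int[of "x - y" "int p"] by linarith
  qed
  from cong_dvd_iff[OF this] 1 have "int p dvd (\<Sum>x\<in>carrier R - {y}. f x)" by simp
  moreover have "moment 0 f = f y + (\<Sum>x\<in>carrier R - {y}. f x)"
    unfolding moment_def using sum.remove[OF finite y] by simp
  moreover have "int p dvd moment 0 f" using M p_gt_1 by simp
  ultimately have "int p dvd f y" by (metis dvd_add_left_iff)
  moreover have "f y \<in> carrier R" using f y carrier_Z by auto
  ultimately have "f y = 0" using zdvd_not_zless[of "f y" "int p"] by (force simp: res_carrier_eq)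
  then show "f y = \<one>\<^bsub>AW.K\<^esub> y" using y by simp
qed (use f in \<open>auto simp: PiE_def\<close>)

definition layer :: "nat \<Rightarrow> ((int \<Rightarrow> int) \<times> (int \<Rightarrow> int)) set" where
  "layer d = {AW.base f | f. f \<in> carrier AW.K \<and> (\<forall>i<d. int p dvd moment i f)}"

lemma layerI:
  assumes "f \<in> carrier AW.K" "\<And>i. i < d \<Longrightarrow> int p dvd moment i f"
  shows "AW.base f \<in> layer d"
  unfolding layer_def using assms by blast

lemma layerE:
  assumes "w \<in> layer d"
  obtains f where "w = AW.base f" "f \<in> carrier AW.K" "\<And>i. i < d \<Longrightarrow> int p dvd moment i f"
  using assms unfolding layer_def by blast

lemma layer_normal: "layer d \<lhd> AW.W"
proof (rule AW.W.normal_invI[OF AW.W.subgroupI])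
  show "layer d \<subseteq> carrier AW.W" unfolding layer_def using AW.base_closed by blast
  show "layer d \<noteq> {}"
  proof -
    have "AW.base \<one>\<^bsub>AW.K\<^esub> \<in> layer d"
      by (rule layerI[OF AW.K.one_closed]) (simp only: moment_one dvd_0_right)
    then show ?thesis by blast
  qed
next
  fix x assume "x \<in> layer d"
  then obtain f where f: "x = AW.base f" "f \<in> carrier AW.K" "\<And>i. i < d \<Longrightarrow> int p dvd moment i f"
    by (rule layerE) blast
  let ?g = "inv\<^bsub>AW.K\<^esub> f"
  have g: "?g \<in> carrier AW.K" by (rule AW.K.inv_closed[OF f(2)])
  have "int p dvd moment i ?g" if "i < d" for i
  proof -
    have "[0 = moment i f + moment i ?g] (mod int p)"
      using moment_mult[of i f ?g] unfolding AW.K.r_inv[OF f(2)] moment_one .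
    then have "int p dvd moment i f + moment i ?g"
      using cong_dvd_iff dvd_0_right by metis
    then show ?thesis using f(3)[OF that] by (simp only: dvd_add_right_iff)
  qed
  then show "inv\<^bsub>AW.W\<^esub> x \<in> layer d"
    unfolding f(1) AW.inv_base[OF f(2)] by (rule layerI[OF g])
  fix y assume "y \<in> layer d"
  then obtain h where h: "y = AW.base h" "h \<in> carrier AW.K" "\<And>i. i < d \<Longrightarrow> int p dvd moment i h"
    by (rule layerE) blast
  have "int p dvd moment i (f \<otimes>\<^bsub>AW.K\<^esub> h)" if "i < d" for i
    unfolding cong_dvd_iff[OF moment_mult] using f(3)[OF that] h(3)[OF that] by (rule dvd_add)
  then show "x \<otimes>\<^bsub>AW.W\<^esub> y \<in> layer d"
    unfolding f(1) h(1) AW.base_mult[OF f(2) h(2)]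
    by (rule layerI[OF AW.K.m_closed[OF f(2) h(2)]])
next
  fix g x assume g: "g \<in> carrier AW.W" and "x \<in> layer d"
  from this(2) obtain f where f: "x = AW.base f" "f \<in> carrier AW.K" "\<And>i. i < d \<Longrightarrow> int p dvd moment i f"
    by (rule layerE) blast
  obtain k \<alpha> where k: "g = (k, \<alpha>)" by (cases g)
  have a: "\<alpha> \<in> affs" using g unfolding k AW.carrier_W by (rule SigmaD2)
  have "int p dvd moment i (AW.act \<alpha> f)" if "i < d" for i
    using moment_act[OF a, of i f] f(3) that by auto
  then show "g \<otimes>\<^bsub>AW.W\<^esub> x \<otimes>\<^bsub>AW.W\<^esub> inv\<^bsub>AW.W\<^esub> g \<in> layer d"
    unfolding k f(1) AW.conj_base[OF g[unfolded k] f(2)]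
    by (rule layerI[OF AW.act_closed[OF a f(2)]])
qed

lemma layer_Suc:
  fixes d :: nat
  defines "h \<equiv> \<lambda>w. moment d (fst w) mod int p"
  shows "h \<in> hom (AW.W\<lparr>carrier := layer d\<rparr>) Z"
    and "kernel (AW.W\<lparr>carrier := layer d\<rparr>) Z h = layer (Suc d)"
proof -
  have h_base: "h (AW.base f) = moment d f mod int p" for f
    by (simp add: h_def wreath_base_def)
  show "h \<in> hom (AW.W\<lparr>carrier := layer d\<rparr>) Z"
  proof (rule homI)
    fix x assume "x \<in> carrier (AW.W\<lparr>carrier := layer d\<rparr>)"
    show "h x \<in> carrier Z" unfolding carrier_Z h_def by (rule mod_in_carrier)
  next
    fix x y assume "x \<in> carrier (AW.W\<lparr>carrier := layer d\<rparr>)" "y \<in> carrier (AW.W\<lparr>carrier := layer d\<rparr>)"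
    then have "x \<in> layer d" "y \<in> layer d" by simp_all
    then obtain f g where f: "x = AW.base f" "f \<in> carrier AW.K" and g: "y = AW.base g" "g \<in> carrier AW.K"
      by (elim layerE) blast
    have "h (x \<otimes>\<^bsub>AW.W\<^esub> y) = (moment d f + moment d g) mod int p"
      unfolding f(1) g(1) AW.base_mult[OF f(2) g(2)] h_base
      using moment_mult[of d f g] unfolding cong_def .
    also have "\<dots> = h x \<otimes>\<^bsub>Z\<^esub> h y"
      unfolding f(1) g(1) h_base by (simp add: mod_simps)
    finally show "h (x \<otimes>\<^bsub>AW.W\<lparr>carrier := layer d\<rparr>\<^esub> y) = h x \<otimes>\<^bsub>Z\<^esub> h y" by simp
  qed
  have "kernel (AW.W\<lparr>carrier := layer d\<rparr>) Z h = {x \<in> layer d. h x = 0}"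
    by (simp add: kernel_def)
  also have "\<dots> = {AW.base f | f. (f \<in> carrier AW.K \<and> (\<forall>i<d. int p dvd moment i f)) \<and> h (AW.base f) = 0}"
    unfolding layer_def by blast
  also have "\<dots> = layer (Suc d)"
    unfolding layer_def h_base dvd_eq_mod_eq_0 [symmetric] less_Suc_eq by blast
  finally show "kernel (AW.W\<lparr>carrier := layer d\<rparr>) Z h = layer (Suc d)" .
qed

text \<open>
  The series is built from \<open>layer p = {1}\<close> upwards, so the induction decreases \<open>d\<close>.
\<close>
lemma supersolvable_seq_layer: "d \<le> p \<Longrightarrow> supersolvable_seq AW.W (layer d)"
proof (induction rule: inc_induct)
  case base
  have "layer p = {\<one>\<^bsub>AW.W\<^esub>}"
  proof (intro equalityI subsetI)
    fix x assume "x \<in> layer p"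
    then obtain f where f: "x = AW.base f" "f \<in> carrier AW.K" "\<And>i. i < p \<Longrightarrow> int p dvd moment i f"
      by (rule layerE) blast
    have "f = \<one>\<^bsub>AW.K\<^esub>" by (rule eq_one_if_moments_vanish[OF f(2)]) (rule f(3))
    then show "x \<in> {\<one>\<^bsub>AW.W\<^esub>}" unfolding f(1) AW.one_W by (simp only: singleton_iff)
  next
    fix x assume "x \<in> {\<one>\<^bsub>AW.W\<^esub>}"
    then show "x \<in> layer p"
      by (simp only: singleton_iff subgroup.one_closed[OF normal_imp_subgroup[OF layer_normal]])
  qed
  then show ?case using supersolvable_seq.unity[of AW.W] by (rule ssubst)
next
  case (step d)
  show ?case
    by (rule supersolvable_seq_kernel[OF AW.W.group_axioms group_integer_mod_group
          cyclic_integer_mod_group[OF p_gt_1] layer_normal layer_Suc(1)])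
      (use step.IH in \<open>simp only: layer_Suc(2)\<close>)
qed

text \<open>
  The coefficient \<open>u\<close> of an affine map \<open>x \<mapsto> u x + v\<close>, read off from its values at \<open>1\<close> and \<open>0\<close>.
\<close>
definition linear_part :: "(int \<Rightarrow> int) \<times> (int \<Rightarrow> int) \<Rightarrow> int" where
  "linear_part w = snd w \<one> \<ominus> snd w \<zero>"

lemma linear_part_aff:
  assumes "u \<in> carrier R" "v \<in> carrier R"
  shows "linear_part (k, aff u v) = u"
proof -
  have "(u \<oplus> v) \<ominus> v = u" using assms by algebra
  then show ?thesis using assms by (simp add: linear_part_def)
qed

lemma carrier_W_cases:
  assumes "w \<in> carrier AW.W"
  obtains k u v where "w = (k, aff u v)" "k \<in> carrier AW.K" "u \<in> carrier R - {\<zero>}" "v \<in> carrier R"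
proof -
  obtain k \<alpha> where w: "w = (k, \<alpha>)" by (cases w)
  have "k \<in> carrier AW.K" "\<alpha> \<in> affs"
    using assms unfolding w AW.carrier_W by (rule SigmaD1, rule SigmaD2)
  then show ?thesis using that w by (metis affsE)
qed

lemma mult_W_aff:
  assumes "u \<in> carrier R - {\<zero>}" "v \<in> carrier R" "u' \<in> carrier R - {\<zero>}" "v' \<in> carrier R"
  shows "(k, aff u v) \<otimes>\<^bsub>AW.W\<^esub> (k', aff u' v') =
    (k \<otimes>\<^bsub>AW.K\<^esub> AW.act (aff u v) k', aff (u \<otimes> u') (u \<otimes> v' \<oplus> v))"
proof -
  have "aff u v \<in> affs" "aff u' v' \<in> affs" using assms by (simp_all only: affsI)
  then show ?thesis using assms unfolding AW.mult_W by (simp only: AW.A_mult compose_aff Diff_iff)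
qed

lemma linear_part_hom: "linear_part \<in> hom AW.W (mult_of R)"
proof (rule homI)
  fix w assume "w \<in> carrier AW.W"
  then obtain k u v where "w = (k, aff u v)" "u \<in> carrier R - {\<zero>}" "v \<in> carrier R"
    by (rule carrier_W_cases) blast
  then show "linear_part w \<in> carrier (mult_of R)" by (simp add: linear_part_aff)
next
  fix w w' assume ww': "w \<in> carrier AW.W" "w' \<in> carrier AW.W"
  obtain k u v where w: "w = (k, aff u v)" "u \<in> carrier R - {\<zero>}" "v \<in> carrier R"
    using ww'(1) by (rule carrier_W_cases) blast
  obtain k' u' v' where w': "w' = (k', aff u' v')" "u' \<in> carrier R - {\<zero>}" "v' \<in> carrier R"
    using ww'(2) by (rule carrier_W_cases) blast
  show "linear_part (w \<otimes>\<^bsub>AW.W\<^esub> w') = linear_part w \<otimes>\<^bsub>mult_of R\<^esub> linear_part w'"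
    unfolding w(1) w'(1) mult_W_aff[OF w(2,3) w'(2,3)]
    using w(2,3) w'(2,3) by (simp add: linear_part_aff)
qed

text \<open>
  The elements whose component in the affine group is a translation \<open>x \<mapsto> x + v\<close>.
\<close>
definition translation_part :: "((int \<Rightarrow> int) \<times> (int \<Rightarrow> int)) set" where
  "translation_part = kernel AW.W (mult_of R) linear_part"

lemma translation_part_normal: "translation_part \<lhd> AW.W"
  unfolding translation_part_def
  by (intro group_hom.normal_kernel group_hom.intro group_hom_axioms.intro
      AW.W.group_axioms field_mult_group linear_part_hom)

lemma translation_part_cases:
  assumes "w \<in> translation_part"
  obtains k v where "w = (k, aff \<one> v)" "k \<in> carrier AW.K" "v \<in> carrier R"
proof -
  have w: "w \<in> carrier AW.W" "linear_part w = \<one>"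
    using assms by (simp_all add: translation_part_def kernel_def)
  obtain k u v where k: "w = (k, aff u v)" "k \<in> carrier AW.K" "u \<in> carrier R - {\<zero>}" "v \<in> carrier R"
    using w(1) by (rule carrier_W_cases)
  then have "u = \<one>" using w(2) by (simp add: linear_part_aff)
  with k show ?thesis by (intro that[of k v]) simp_all
qed

text \<open>
  For a translation \<open>x \<mapsto> x + v\<close> the value at \<open>0\<close> is \<open>v\<close>, and composing translations adds these values.
  If \<open>v = 0\<close>, the element lies in the base group, which is \<open>layer 0\<close>.
\<close>
lemma offset_hom:
  defines "h \<equiv> \<lambda>w. snd w \<zero>"
  shows "h \<in> hom (AW.W\<lparr>carrier := translation_part\<rparr>) Z"
    and "kernel (AW.W\<lparr>carrier := translation_part\<rparr>) Z h = layer 0"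
proof -
  have h: "h (k, aff u v) = v" if "u \<in> carrier R" "v \<in> carrier R" for k :: "int \<Rightarrow> int" and u v
    using that by (simp add: h_def)
  have nz: "\<one> \<in> carrier R - {\<zero>}" by simp
  show "h \<in> hom (AW.W\<lparr>carrier := translation_part\<rparr>) Z"
  proof (rule homI)
    fix w assume "w \<in> carrier (AW.W\<lparr>carrier := translation_part\<rparr>)"
    then have "w \<in> translation_part" by simp
    then obtain k v where "w = (k, aff \<one> v)" "v \<in> carrier R"
      by (rule translation_part_cases) blast
    then show "h w \<in> carrier Z" unfolding carrier_Z by (simp add: h)
  next
    fix w w' assume "w \<in> carrier (AW.W\<lparr>carrier := translation_part\<rparr>)"
      "w' \<in> carrier (AW.W\<lparr>carrier := translation_part\<rparr>)"
    then have ww': "w \<in> translation_part" "w' \<in> translation_part" by simp_all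
    obtain k v where w: "w = (k, aff \<one> v)" "v \<in> carrier R"
      using ww'(1) by (rule translation_part_cases) blast
    obtain k' v' where w': "w' = (k', aff \<one> v')" "v' \<in> carrier R"
      using ww'(2) by (rule translation_part_cases) blast
    have "h (w \<otimes>\<^bsub>AW.W\<^esub> w') = v' \<oplus> v"
      unfolding w(1) w'(1) mult_W_aff[OF nz w(2) nz w'(2)] using w(2) w'(2) by (simp add: h)
    also have "\<dots> = h w \<otimes>\<^bsub>Z\<^esub> h w'"
      unfolding w(1) w'(1) using w(2) w'(2) by (simp add: h res_add_eq add.commute)
    finally show "h (w \<otimes>\<^bsub>AW.W\<lparr>carrier := translation_part\<rparr>\<^esub> w') = h w \<otimes>\<^bsub>Z\<^esub> h w'" by simp
  qed
  have one: "\<one>\<^bsub>AW.A_grp\<^esub> = aff \<one> \<zero>" by (simp add: aff_one BijGroup_def)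
  show "kernel (AW.W\<lparr>carrier := translation_part\<rparr>) Z h = layer 0"
  proof (intro equalityI subsetI)
    fix w assume "w \<in> kernel (AW.W\<lparr>carrier := translation_part\<rparr>) Z h"
    then have w: "w \<in> translation_part" "h w = \<zero>" by (simp_all add: kernel_def res_zero_eq)
    obtain k v where k: "w = (k, aff \<one> v)" "k \<in> carrier AW.K" "v \<in> carrier R"
      using w(1) by (rule translation_part_cases) blast
    have "v = \<zero>" using w(2) unfolding k(1) h[OF one_closed k(3)] .
    then have "w = AW.base k" by (simp only: k(1) wreath_base_def one)
    then show "w \<in> layer 0" using layerI[OF k(2), of 0] by blast
  next
    fix w assume "w \<in> layer 0"
    then obtain k where k: "w = AW.base k" "k \<in> carrier AW.K" by (rule layerE) blast
    have "w \<in> carrier AW.W" unfolding k(1) by (rule AW.base_closed[OF k(2)])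
    moreover have "w = (k, aff \<one> \<zero>)" unfolding k(1) wreath_base_def one by (rule refl)
    ultimately show "w \<in> kernel (AW.W\<lparr>carrier := translation_part\<rparr>) Z h"
      by (simp add: kernel_def translation_part_def linear_part_aff h res_zero_eq [symmetric])
  qed
qed

theorem supersolvable_affine_wreath: "supersolvable AW.W"
proof -
  have "supersolvable_seq AW.W translation_part"
    by (rule supersolvable_seq_kernel[OF AW.W.group_axioms group_integer_mod_group
          cyclic_integer_mod_group[OF p_gt_1] translation_part_normal offset_hom(1)])
      (simp only: offset_hom(2) supersolvable_seq_layer[of 0])
  moreover have "AW.W\<lparr>carrier := carrier AW.W\<rparr> = AW.W" by simp
  ultimately show ?thesis
    using supersolvable_seq_kernel[OF AW.W.group_axioms field_mult_group cyclic_mult_of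
        AW.W.normal_self, of linear_part] linear_part_hom
    unfolding supersolvable_def translation_part_def by (simp only:)
qed

end

section \<open>The wreath product of a cyclic group of prime order and an affine group\<close>

context residues_prime
begin

lemma zero_one: "(0::int) \<in> carrier R" "(1::int) \<in> carrier R" "(0::int) \<noteq> 1"
  using p_gt_1 by (simp_all add: res_carrier_eq)

lemma fun_of_tuple_eq:
  assumes "length xs = p"
  shows "fun_of_tuple xs = (\<lambda>i\<in>carrier R. xs ! nat i)"
  by (simp add: fun_of_tuple_def assms res_carrier_eq)

lemma fun_of_tuple_const:
  "fun_of_tuple (replicate p e) = (\<lambda>i\<in>carrier R. e)"
  by (subst fun_of_tuple_eq) (auto simp: res_carrier_eq intro!: restrict_ext)

lemma fun_of_tuple_delta:
  "fun_of_tuple (c # replicate (p - 1) \<one>\<^bsub>C\<^esub>) = delta C (carrier R) 0 c"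
  using p_gt_1 unfolding delta_def
  by (subst fun_of_tuple_eq) (auto simp: res_carrier_eq nth_Cons' intro!: restrict_ext)

lemma fun_of_tuple_delta_pair:
  assumes "monoid C" "c \<in> carrier C" "d \<in> carrier C"
  shows "fun_of_tuple (c # d # replicate (p - 2) \<one>\<^bsub>C\<^esub>) =
    delta C (carrier R) 0 c \<otimes>\<^bsub>product_group (carrier R) (\<lambda>_. C)\<^esub> delta C (carrier R) 1 d"
proof -
  interpret C: monoid C by fact
  show ?thesis
    using p_gt_1 assms unfolding delta_def
    by (subst fun_of_tuple_eq)
      (auto simp: res_carrier_eq nth_Cons' nat_le_iff intro!: restrict_ext)
qed

theorem wreath_conj_class_products:
  fixes C :: "'c monoid" and c :: 'c
  assumes C: "group C" "order C = p" "c \<in> carrier C" "subgroup_generated C {c} = C"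
  defines "A \<equiv> aff_group R"
  defines "G \<equiv> wreath C A (carrier R)"
  defines "a \<equiv> wreath_base A (fun_of_tuple (c # replicate (p - 1) \<one>\<^bsub>C\<^esub>))"
  shows "a \<in> carrier G"
    and "card (conj_class G a) = p"
    and "conj_class G a <#>\<^bsub>G\<^esub> conj_class G (inv\<^bsub>G\<^esub> a) =
      conj_class G (wreath_base A (fun_of_tuple (replicate p \<one>\<^bsub>C\<^esub>))) \<union>
      conj_class G (wreath_base A (fun_of_tuple (c # inv\<^bsub>C\<^esub> c # replicate (p - 2) \<one>\<^bsub>C\<^esub>)))"
    and "eta G (conj_class G a <#>\<^bsub>G\<^esub> conj_class G (inv\<^bsub>G\<^esub> a)) = 2"
proof -
  interpret C: group C by fact
  have "cyclic_group C" unfolding cyclic_group_def using C(3,4) by blast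
  then have "comm_group C" by (rule C.cyclic_imp_abelian_group)
  then interpret V: two_transitive_wreath C affs "carrier R"
    by (intro two_transitive_wreath.intro two_transitive_wreath_axioms.intro
        abelian_wreath.intro abelian_wreath_axioms.intro
        subgroup_affs affs_two_transitive)
  \<comment> \<open>the identity generates a group of order \<open>1 < p\<close>\<close>
  have c: "c \<noteq> \<one>\<^bsub>C\<^esub>"
  proof
    assume "c = \<one>\<^bsub>C\<^esub>"
    then have "carrier C = {\<one>\<^bsub>C\<^esub>}"
      using C.carrier_subgroup_generated_by_singleton[OF C(3)] C(4) by auto
    then show False using C(2) p_gt_1 by (simp add: order_def)
  qed
  have A: "A = V.A_grp" unfolding A_def by (rule aff_group_eq)
  have G: "G = V.W" unfolding G_def A ..
  have a: "a = V.base (V.\<delta> 0 c)" unfolding a_def A fun_of_tuple_delta ..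
  have card: "card (carrier R) = p" by (simp add: res_carrier_eq)
  note products = V.conj_class_delta_products[OF zero_one C(3) c, folded a]
  show "a \<in> carrier G" unfolding G a by (intro V.base_closed V.delta_closed C(3))
  show "card (conj_class G a) = p" unfolding G products(1) by (rule card)
  have pair: "fun_of_tuple (c # inv\<^bsub>C\<^esub> c # replicate (p - 2) \<one>\<^bsub>C\<^esub>) = V.\<delta> 0 c \<otimes>\<^bsub>V.K\<^esub> V.\<delta> 1 (inv\<^bsub>C\<^esub> c)"
    by (rule fun_of_tuple_delta_pair[OF C.is_monoid C(3) C.inv_closed[OF C(3)]])
  have const: "fun_of_tuple (replicate p \<one>\<^bsub>C\<^esub>) = \<one>\<^bsub>V.K\<^esub>"
    unfolding fun_of_tuple_const by simp
  show "conj_class G a <#>\<^bsub>G\<^esub> conj_class G (inv\<^bsub>G\<^esub> a) =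
      conj_class G (wreath_base A (fun_of_tuple (replicate p \<one>\<^bsub>C\<^esub>))) \<union>
      conj_class G (wreath_base A (fun_of_tuple (c # inv\<^bsub>C\<^esub> c # replicate (p - 2) \<one>\<^bsub>C\<^esub>)))"
    unfolding G A pair const by (rule products(2))
  show "eta G (conj_class G a <#>\<^bsub>G\<^esub> conj_class G (inv\<^bsub>G\<^esub> a)) = 2"
    unfolding G by (rule products(3))
qed

text \<open>
  The wreath product for \<open>C = \<int>/p\<close>, transported to natural numbers.
\<close>
theorem supersolvable_example:
  "\<exists>(G :: nat monoid) a.
    group G \<and> finite (carrier G) \<and> supersolvable G \<and> a \<in> carrier G \<and>
    card (conj_class G a) = p \<and>
    eta G (conj_class G a <#>\<^bsub>G\<^esub> conj_class G (inv\<^bsub>G\<^esub> a)) = 2"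
proof -
  have Z1: "1 \<in> carrier Z" "(1::int) \<noteq> \<one>\<^bsub>Z\<^esub>"
    using p_gt_1 by simp_all
  let ?a = "AW.base (AW.\<delta> 0 1)"
  have a: "?a \<in> carrier AW.W" by (intro AW.base_closed AW.delta_closed Z1)
  have card: "card (carrier R) = p" by (simp add: res_carrier_eq)
  note products = AW.conj_class_delta_products[OF zero_one Z1, unfolded card]
  have "finite (carrier AW.K)" using carrier_Z by (simp add: finite_PiE)
  moreover have "finite affs"
  proof (rule finite_subset)
    show "affs \<subseteq> (\<lambda>(u, v). aff u v) ` (carrier R \<times> carrier R)"
      unfolding affs_def by auto
  qed simp
  ultimately have finite_W: "finite (carrier AW.W)"
    unfolding AW.carrier_W by (rule finite_cartesian_product)
  obtain G :: "nat monoid" and f where G: "group G" "f \<in> iso G AW.W"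
    by (rule finite_group_iso_nat[OF AW.W.group_axioms finite_W])
  have f: "f \<in> hom G AW.W" "bij_betw f (carrier G) (carrier AW.W)"
    using G(2) by (simp_all only: iso_def mem_Collect_eq)
  have "?a \<in> f ` carrier G" using a bij_betw_imp_surj_on[OF f(2)] by (simp only:)
  then obtain b where b: "?a = f b" "b \<in> carrier G" by (rule imageE)
  note inv = iso_conj_class_invariants[OF G(1) AW.W.group_axioms G(2) b(2), folded b(1),
      unfolded products(1,3)]
  show ?thesis
  proof (intro exI conjI)
    show "finite (carrier G)"
      using bij_betw_finite[OF f(2)] finite_W by simp
    show "supersolvable G"
      using supersolvable_inj_hom[OF G(1) AW.W.group_axioms f(1) _ supersolvable_affine_wreath]
        bij_betw_imp_inj_on[OF f(2)] by (simp only:)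
  qed (rule G(1) b(2) inv [symmetric])+
qed

end

theorem proposition5p5:
  fixes p :: nat
  assumes "Factorial_Ring.prime p"
  shows
    "(\<forall>(C :: 'c monoid) c.
        group C \<and> order C = p \<and> c \<in> carrier C \<and> subgroup_generated C {c} = C \<longrightarrow>
        (let F = residue_ring (int p);
             A = aff_group F;
             G = wreath C A (carrier F);
             e = \<one>\<^bsub>C\<^esub>;
             a = wreath_base A (fun_of_tuple (c # replicate (p - 1) e))
         in a \<in> carrier G \<and>
            card (conj_class G a) = p \<and>
            conj_class G a <#>\<^bsub>G\<^esub> conj_class G (inv\<^bsub>G\<^esub> a) =
              conj_class G (wreath_base A (fun_of_tuple (replicate p e))) \<union>
              conj_class G (wreath_base A (fun_of_tuple (c # inv\<^bsub>C\<^esub> c # replicate (p - 2) e))) \<and>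
            eta G (conj_class G a <#>\<^bsub>G\<^esub> conj_class G (inv\<^bsub>G\<^esub> a)) = 2)) \<and>
     (\<exists>(G :: nat monoid) a.
        group G \<and> finite (carrier G) \<and> supersolvable G \<and> a \<in> carrier G \<and>
        card (conj_class G a) = p \<and>
        eta G (conj_class G a <#>\<^bsub>G\<^esub> conj_class G (inv\<^bsub>G\<^esub> a)) = 2)"
proof -
  interpret residues_prime p "residue_ring (int p)"
    using assms by unfold_locales simp
  show ?thesis
    unfolding Let_def
    by (intro conjI allI impI; (elim conjE)?)
      (rule wreath_conj_class_products supersolvable_example; assumption)+
qed

end
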